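(* Let $d\ge1$ and let $V,\psi:\mathbb{R}^d\to\mathbb{R}$ satisfy assumptions (V1)–(V4) and ($\psi$1)–($\psi$3) listed in the context. For any $\lambda>0$ there exists a stationary measure of the Vlasov-Fokker-Planck equation, that is, a probability density $\rho$ on $\mathbb{R}^{2d}$ solving $$-\mathrm{div}_q(\rho p)+\mathrm{div}_p\big(\rho(\nabla_qV+\nabla_q\psi\ast\rho+p)\big)+\lambda\Delta_p\rho=0 .$$
   Context: Coordinates on $\mathbb{R}^{2d}$ are $(q,p)\in\mathbb{R}^d\times\mathbb{R}^d$; subscripts on differential operators indicate the variables on which they act. $(\psi\ast\rho)(q)=\int_{\mathbb{R}^{2d}}\psi(q-q')\rho(q',p')\,dq'dp'$. The (dimensionless) Vlasov-Fokker-Planck equation is $\partial_t\rho=-\mathrm{div}_q(\rho p)+\mathrm{div}_p(\rho(\nabla_qV+\nabla_q\psi\ast\rho+p))+\lambda\Delta_p\rho$. Stationary measures are probability densities in $L^1\cap L^\infty(\mathbb{R}^{2d})$ with $\psi\ast\rho$, $\nabla\psi\ast\rho$ well defined. Assumptions on $V$: (V1) $V$ is smooth and there exist an integer $m\ge1$ and $C_{2m}>0$ with $\lim_{|x|\to\infty}V(x)/|x|^{2m}=C_{2m}$. (V2) $\nabla V(x)=0$ has finitely many solutions. (V3) There are $C_2,C_4>0$ with $V(x)\ge C_4|x|^4-C_2|x|^2$ for all $x\in\mathbb{R}^d$. (V4) $\mathrm{Hess}\,V(x)\to+\infty$ as $|x|\to\infty$ (i.e. its smallest eigenvalue tends to $+\infty$),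 and $\mathrm{Hess}\,V(x)>0$ for all $x\notin K$, where $K\subset\mathbb{R}^d$ is a compact set containing all critical points of $V$. Assumptions on $\psi$: ($\psi$1) $\psi(x)=G(|x|)$ for an even polynomial $G$ on $\mathbb{R}$ with $\deg G=:2n\ge2$. ($\psi$2) $G$ and $G''$ are convex. ($\psi$3) $G(0)=0$. *)

theory Defs
  imports "HOL-Analysis.Analysis" "HOL-Computational_Algebra.Polynomial"
begin

definition grad :: "('a::euclidean_space \<Rightarrow> real) \<Rightarrow> 'a \<Rightarrow> 'a" where
  "grad f x = (\<Sum>i\<in>Basis. frechet_derivative f (at x) i *\<^sub>R i)"

definition divergence :: "('a::euclidean_space \<Rightarrow> 'a) \<Rightarrow> 'a \<Rightarrow> real" where
  "divergence F x = (\<Sum>i\<in>Basis. frechet_derivative F (at x) i \<bullet> i)"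

definition laplacian :: "('a::euclidean_space \<Rightarrow> real) \<Rightarrow> 'a \<Rightarrow> real" where
  "laplacian f = divergence (grad f)"

definition hessian :: "(real ^ 'd \<Rightarrow> real) \<Rightarrow> real ^ 'd \<Rightarrow> real ^ 'd ^ 'd" where
  "hessian f x = matrix (frechet_derivative (grad f) (at x))"

text \<open>These operators have no meaning where the derivative does not exist, so they are only
  used on functions that are required to be sufficiently often continuously differentiable.\<close>

primrec Ck :: "nat \<Rightarrow> ('a::euclidean_space \<Rightarrow> real) \<Rightarrow> bool" where
  "Ck 0 f \<longleftrightarrow> continuous_on UNIV f"
| "Ck (Suc k) f \<longleftrightarrow> f differentiable_on UNIV
      \<and> (\<forall>i\<in>Basis. Ck k (\<lambda>x. frechet_derivative f (at x) i))"

definition smooth :: "('a::euclidean_space \<Rightarrow> real) \<Rightarrow> bool" where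
  "smooth f \<longleftrightarrow> (\<forall>k. Ck k f)"

definition eigenvalues :: "real ^ 'd ^ 'd \<Rightarrow> real set" where
  "eigenvalues A = {\<mu>. \<exists>v. v \<noteq> 0 \<and> A *v v = \<mu> *\<^sub>R v}"

text \<open>Only used for symmetric matrices, whose set of real eigenvalues is finite and nonempty.\<close>

definition min_eigenvalue :: "real ^ 'd ^ 'd \<Rightarrow> real" where
  "min_eigenvalue A = Min (eigenvalues A)"

definition pos_definite :: "real ^ 'd ^ 'd \<Rightarrow> bool" where
  "pos_definite A \<longleftrightarrow> (\<forall>v. v \<noteq> 0 \<longrightarrow> v \<bullet> (A *v v) > 0)"

text \<open>The convolution acts on the position variable only; the momentum is integrated out.
  It is used both for the real-valued \<open>\<psi>\<close> and for its vector-valued gradient.\<close>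

definition conv_defined ::
    "('a::euclidean_space \<Rightarrow> 'b::euclidean_space) \<Rightarrow> ('a \<times> 'a \<Rightarrow> real) \<Rightarrow> bool" where
  "conv_defined \<psi> \<rho> \<longleftrightarrow> (\<forall>q. integrable lborel (\<lambda>(q', p'). \<rho> (q', p') *\<^sub>R \<psi> (q - q')))"

definition conv ::
    "('a::euclidean_space \<Rightarrow> 'b::euclidean_space) \<Rightarrow> ('a \<times> 'a \<Rightarrow> real) \<Rightarrow> 'a \<Rightarrow> 'b" where
  "conv \<psi> \<rho> q = (\<integral>(q', p'). \<rho> (q', p') *\<^sub>R \<psi> (q - q') \<partial>lborel)"

definition probability_density :: "('a::euclidean_space \<Rightarrow> real) \<Rightarrow> bool" where
  "probability_density \<rho> \<longleftrightarrow> (\<forall>z. 0 \<le> \<rho> z) \<and> has_bochner_integral lborel \<rho> 1"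

definition essentially_bounded :: "('a::euclidean_space \<Rightarrow> real) \<Rightarrow> bool" where
  "essentially_bounded \<rho> \<longleftrightarrow> (\<exists>C. AE z in lborel. \<bar>\<rho> z\<bar> \<le> C)"

text \<open>The stationary equation is read pointwise, for a twice continuously differentiable density;
  such a density also solves it in the sense of distributions.  Conversely, for smooth \<open>V\<close> and
  polynomial \<open>\<psi>\<close> the equation is hypoelliptic, so a distributional solution has a smooth
  version and the two readings describe the same measures.\<close>

definition stationary_measure ::
    "('a::euclidean_space \<Rightarrow> real) \<Rightarrow> ('a \<Rightarrow> real) \<Rightarrow> real \<Rightarrow> ('a \<times> 'a \<Rightarrow> real) \<Rightarrow> bool" where
  "stationary_measure V \<psi> lam \<rho> \<longleftrightarrow>
     probability_density \<rho> \<and> essentially_bounded \<rho> \<and>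
     conv_defined \<psi> \<rho> \<and> conv_defined (grad \<psi>) \<rho> \<and>
     Ck 2 \<rho> \<and>
     (\<forall>q p. - divergence (\<lambda>q. \<rho> (q, p) *\<^sub>R p) q
          + divergence (\<lambda>p. \<rho> (q, p) *\<^sub>R (grad V q + conv (grad \<psi>) \<rho> q + p)) p
          + lam * laplacian (\<lambda>p. \<rho> (q, p)) p = 0)"

end

theory Submission
  imports Defs "HOL-Probability.Distributions"
begin

text \<open>
  Let \<open>g\<close> be the centred Gaussian of variance \<open>\<lambda>\<close> in the momentum.  A product \<open>\<rho>(q,p) = u(q) g(p)\<close>
  with \<open>u\<close> proportional to \<open>exp (-(V + W) / \<lambda>)\<close> annihilates the equation as soon as
  \<open>W = \<psi> \<ast> u\<close>: the transport term cancels the force term, and friction cancels diffusion.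
  Everything therefore rests on solving the self-consistency equation for \<open>W\<close>.

  \<^item> \<^emph>\<open>Reduction to finitely many unknowns.\<close>  Since \<open>G\<close> is an even polynomial, \<open>\<psi>(x - y)\<close> is a polynomial in
    the coordinates of \<open>x\<close> and \<open>y\<close>, hence a finite sum of products \<open>\<phi>\<^sub>i(x) \<eta>\<^sub>i(y)\<close>
    (\<open>separable_even_poly_norm_diff\<close>).  Then \<open>W = (\<Sum>i<N. a\<^sub>i \<phi>\<^sub>i)\<close>, where \<open>a\<^sub>i\<close> is the \<open>\<eta>\<^sub>i\<close>-moment of \<open>u\<close>,
    and the equation becomes \<open>a = M(a)\<close> with a continuous map \<open>M\<close> on \<open>N\<close>-tuples of reals.
    The number \<open>N\<close> depends on the degree of \<open>G\<close>, so Brouwer's theorem is derived from Kuhn's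
    combinatorial lemma for maps on sequences of reals of which only the first \<open>N\<close> entries matter.

  \<^item> \<^emph>\<open>Continuation.\<close>  The confinement \<open>V\<close> need not dominate \<open>\<psi>\<close>, so \<open>M\<close> has no evident invariant cube.
    By \<open>leray_schauder_coordinates\<close> it is enough to bound the solutions of \<open>a = s M(a)\<close> with
    \<open>0 \<le> s \<le> 1\<close>, uniformly in \<open>s\<close>; such an \<open>a\<close> gives \<open>W = s (\<psi> \<ast> u)\<close>.

  \<^item> \<^emph>\<open>Virial estimate.\<close>  Comparing the integral of \<open>exp (-(V + W) / \<lambda>)\<close> with its image under \<open>x \<mapsto> r x\<close> and
    letting \<open>r\<close> tend to 1 bounds the mean of \<open>x \<bullet> \<nabla>(V + W)\<close> under \<open>u\<close> (\<open>virial_inequality\<close>).  Outside a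
    compact set the Hessian of \<open>V\<close> is positive, so \<open>V\<close> is semiconvex along rays, and with the quartic lower
    bound on \<open>V\<close> this makes \<open>x \<bullet> \<nabla>V\<close> at least \<open>|x|\<^sup>2 - c\<close>.  In the double integral of \<open>x \<bullet> \<nabla>\<psi>(x - y)\<close> the roles of \<open>x\<close> and \<open>y\<close> can be
    exchanged, which leaves half the integral of \<open>(x - y) \<bullet> \<nabla>\<psi>(x - y)\<close>, and this is at least
    \<open>\<psi>(x - y)\<close> by convexity of \<open>G\<close>.  Together: the mean of \<open>|x|\<^sup>2 + W / 2\<close> under \<open>u\<close> is bounded
    (\<open>energy_estimate\<close>).

  \<^item> \<^emph>\<open>Conclusion.\<close>  Hence \<open>|m|\<^sup>2 + W(m) / 2\<close> is bounded at some point \<open>m\<close>.  A unit step changes \<open>\<psi>\<close> by at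
    most a factor, up to an additive constant, so \<open>V + W\<close> is bounded on the unit ball around \<open>m\<close> and the
    normalising constant is bounded below (\<open>Z_lower_bound\<close>).  Since \<open>W \<ge> 0\<close>, the density is then
    dominated by a multiple of \<open>exp (-V / \<lambda>)\<close>, and all moments are bounded.
\<close>

section \<open>Brouwer and Leray--Schauder in finitely many coordinates\<close>

lemma bounded_coordinates_convergent_subseq:
  fixes a :: "nat \<Rightarrow> nat \<Rightarrow> real"
  assumes "\<And>k j. j < N \<Longrightarrow> \<bar>a k j\<bar> \<le> R"
  shows "\<exists>l r. strict_mono r \<and> (\<forall>j<N. (\<lambda>k. a (r k) j) \<longlonglongrightarrow> l j)"
  using assms
proof (induction N)
  case 0
  have "strict_mono (id :: nat \<Rightarrow> nat)" by (simp add: strict_mono_def)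
  then show ?case by blast
next
  case (Suc N)
  have "\<And>k j. j < N \<Longrightarrow> \<bar>a k j\<bar> \<le> R" using Suc.prems by simp
  from Suc.IH[OF this] obtain l r where r: "strict_mono r" and l: "\<forall>j<N. (\<lambda>k. a (r k) j) \<longlonglongrightarrow> l j" by blast
  have "\<forall>k. a (r k) N \<in> {-R..R}"
    using Suc.prems[of N] by (auto simp: abs_le_iff minus_le_iff)
  with compact_imp_seq_compact[OF compact_Icc[of "-R" R], unfolded seq_compact_def, THEN spec, of "\<lambda>k. a (r k) N"]
  obtain y s where s: "strict_mono s" and y: "((\<lambda>k. a (r k) N) \<circ> s) \<longlonglongrightarrow> y"
    by blast
  have "(\<lambda>k. a ((r \<circ> s) k) j) \<longlonglongrightarrow> (if j = N then y else l j)" if "j < Suc N" for j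
  proof (cases "j = N")
    case True then show ?thesis using y by (simp add: o_def)
  next
    case False
    then have "(\<lambda>k. a (r k) j) \<longlonglongrightarrow> l j" using l that by simp
    from LIMSEQ_subseq_LIMSEQ[OF this s] False show ?thesis by (simp add: o_def)
  qed
  moreover have "strict_mono (r \<circ> s)" using r s by (rule strict_mono_o)
  ultimately show ?case by (intro exI[of _ "\<lambda>j. if j = N then y else l j"] exI[of _ "r \<circ> s"]) blast
qed

text \<open>A grid point gets label 0 or 1 in direction \<open>i\<close> according to whether the map moves it up or down
  there.  Kuhn's lemma provides, on ever finer grids, a cell in which both labels occur in every
  direction; a limit of these cells is moved neither up nor down.  Continuity is required along
  sequences that converge in the first \<open>N\<close> coordinates, the form in which dominated convergence
  delivers it.\<close>

lemma brouwer_cube_coordinates: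
  fixes f :: "(nat \<Rightarrow> real) \<Rightarrow> nat \<Rightarrow> real"
  assumes R: "R > 0"
    and into: "\<And>a i. (\<And>j. j < N \<Longrightarrow> \<bar>a j\<bar> \<le> R) \<Longrightarrow> i < N \<Longrightarrow> \<bar>f a i\<bar> \<le> R"
    and cont: "\<And>a l i. (\<And>k j. j < N \<Longrightarrow> \<bar>a k j\<bar> \<le> R) \<Longrightarrow>
        (\<And>j. j < N \<Longrightarrow> (\<lambda>k. a k j) \<longlonglongrightarrow> l j) \<Longrightarrow> i < N \<Longrightarrow> (\<lambda>k. f (a k) i) \<longlonglongrightarrow> f l i"
  obtains a where "\<And>j. j < N \<Longrightarrow> \<bar>a j\<bar> \<le> R" "\<And>i. i < N \<Longrightarrow> f a i = a i"
proof -
  define g where "g p x i = R * (2 * (real (x i) / real p) - 1)" for p :: nat and x :: "nat \<Rightarrow> nat" and i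
  define lab where "lab p x i = (if x i \<noteq> p \<and> (x i = 0 \<or> f (g p x) i \<ge> g p x i) then 0 else 1::nat)"
    for p x i
  have g_bound: "\<bar>g p x i\<bar> \<le> R" if "x i \<le> p" "p > 0" for p x i
  proof -
    have "0 \<le> real (x i) / real p" "real (x i) / real p \<le> 1" using that by auto
    then have "\<bar>2 * (real (x i) / real p) - 1\<bar> \<le> 1" by linarith
    then have "R * \<bar>2 * (real (x i) / real p) - 1\<bar> \<le> R * 1"
      using R by (intro mult_left_mono) auto
    then show ?thesis using R by (simp add: g_def abs_mult)
  qed
  have lab0: "f (g p x) i \<ge> g p x i" if "\<And>j. j < N \<Longrightarrow> x j \<le> p" "i < N" "p > 0" "lab p x i = 0" for p x i
  proof (cases "x i = 0")
    case True
    then have "g p x i = -R" by (simp add: g_def)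
    moreover have "\<bar>f (g p x) i\<bar> \<le> R" using that g_bound by (intro into) auto
    ultimately show ?thesis by linarith
  qed (use that in \<open>auto simp: lab_def split: if_splits\<close>)
  have lab1: "f (g p x) i \<le> g p x i" if "\<And>j. j < N \<Longrightarrow> x j \<le> p" "i < N" "p > 0" "lab p x i \<noteq> 0" for p x i
  proof (cases "x i = p")
    case True
    then have "g p x i = R" using \<open>p > 0\<close> by (simp add: g_def)
    moreover have "\<bar>f (g p x) i\<bar> \<le> R" using that g_bound by (intro into) auto
    ultimately show ?thesis by linarith
  qed (use that in \<open>auto simp: lab_def split: if_splits\<close>)
  \<comment> \<open>\<open>q\<close> is the lower corner of a grid cell; in each direction \<open>i\<close> the map moves the corner \<open>u i\<close> up and the
    corner \<open>v i\<close> down.\<close>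
  define cell where "cell p q u v \<longleftrightarrow> (\<forall>i<N. q i < p)
      \<and> (\<forall>i<N. (\<forall>j<N. q j \<le> u i j \<and> u i j \<le> q j + 1 \<and> q j \<le> v i j \<and> v i j \<le> q j + 1)
          \<and> f (g p (u i)) i \<ge> g p (u i) i \<and> f (g p (v i)) i \<le> g p (v i) i)" for p q u v
  have "\<exists>q u v. cell p q u v" if p: "p > 0" for p
  proof -
    obtain q where q: "\<forall>i<N. q i < p"
      and ex: "\<forall>i<N. \<exists>r s. (\<forall>j<N. q j \<le> r j \<and> r j \<le> q j + 1)
        \<and> (\<forall>j<N. q j \<le> s j \<and> s j \<le> q j + 1) \<and> lab p r i \<noteq> lab p s i"
      by (rule kuhn_lemma[of p N "lab p"]) (use p in \<open>auto simp: lab_def\<close>)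
    have "\<exists>u v. (\<forall>j<N. q j \<le> u j \<and> u j \<le> q j + 1 \<and> q j \<le> v j \<and> v j \<le> q j + 1)
        \<and> f (g p u) i \<ge> g p u i \<and> f (g p v) i \<le> g p v i" if i: "i < N" for i
    proof -
      obtain r s where r: "\<forall>j<N. q j \<le> r j \<and> r j \<le> q j + 1" and s: "\<forall>j<N. q j \<le> s j \<and> s j \<le> q j + 1"
        and ne: "lab p r i \<noteq> lab p s i" using ex i by blast
      have rp: "r j \<le> p" and sp: "s j \<le> p" if "j < N" for j
        using r[rule_format, OF that] s[rule_format, OF that] q[rule_format, OF that] by linarith+
      show ?thesis
      proof (cases "lab p r i = 0")
        case True
        have "f (g p r) i \<ge> g p r i" by (rule lab0) (use rp i p True in auto)
        moreover have "f (g p s) i \<le> g p s i" by (rule lab1) (use sp i p True ne in auto)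
        ultimately show ?thesis using r s by blast
      next
        case False
        then have s0: "lab p s i = 0" using ne by (auto simp: lab_def split: if_splits)
        have "f (g p s) i \<ge> g p s i" by (rule lab0) (use sp i p s0 in auto)
        moreover have "f (g p r) i \<le> g p r i" by (rule lab1) (use rp i p False in auto)
        ultimately show ?thesis using r s by blast
      qed
    qed
    then have "\<forall>i\<in>{..<N}. \<exists>uv. (\<forall>j<N. q j \<le> fst uv j \<and> fst uv j \<le> q j + 1 \<and> q j \<le> snd uv j \<and> snd uv j \<le> q j + 1)
        \<and> f (g p (fst uv)) i \<ge> g p (fst uv) i \<and> f (g p (snd uv)) i \<le> g p (snd uv) i" by simp
    from bchoice[OF this] obtain uv where "\<forall>i\<in>{..<N}. (\<forall>j<N. q j \<le> fst (uv i) j \<and> fst (uv i) j \<le> q j + 1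
          \<and> q j \<le> snd (uv i) j \<and> snd (uv i) j \<le> q j + 1)
        \<and> f (g p (fst (uv i))) i \<ge> g p (fst (uv i)) i \<and> f (g p (snd (uv i))) i \<le> g p (snd (uv i)) i" ..
    with q have "cell p q (\<lambda>i. fst (uv i)) (\<lambda>i. snd (uv i))" by (simp add: cell_def)
    then show ?thesis by blast
  qed
  then have "\<exists>q u v. cell (Suc k) q u v" for k by simp
  then obtain q u v where cell: "\<And>k. cell (Suc k) (q k) (u k) (v k)" by metis
  have q: "q k i < Suc k" if "i < N" for k i using cell[of k] that by (simp add: cell_def)
  have near: "q k j \<le> u k i j \<and> u k i j \<le> q k j + 1 \<and> q k j \<le> v k i j \<and> v k i j \<le> q k j + 1"
    if "i < N" "j < N" for k i j using cell[of k] that by (simp add: cell_def)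
  have sgn: "f (g (Suc k) (u k i)) i \<ge> g (Suc k) (u k i) i \<and> f (g (Suc k) (v k i)) i \<le> g (Suc k) (v k i) i"
    if "i < N" for k i using cell[of k] that by (simp add: cell_def)
  have "\<bar>g (Suc k) (q k) j\<bar> \<le> R" if "j < N" for k j
    using q[OF that, of k] by (intro g_bound) auto
  then obtain l r where r: "strict_mono r" and l: "\<And>j. j < N \<Longrightarrow> (\<lambda>k. g (Suc (r k)) (q (r k)) j) \<longlonglongrightarrow> l j"
    using bounded_coordinates_convergent_subseq[of N "\<lambda>k. g (Suc k) (q k)" R] by blast
  have mesh: "(\<lambda>k. 2 * R / real (Suc (r k))) \<longlonglongrightarrow> 0"
    using LIMSEQ_subseq_LIMSEQ[OF lim_const_over_n[of "2 * R", THEN LIMSEQ_Suc] r] by (simp add: o_def)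
  have close: "(\<lambda>k. g (Suc (r k)) (x (r k)) j) \<longlonglongrightarrow> l j"
    if j: "j < N" and x: "\<And>k. q k j \<le> x k j \<and> x k j \<le> q k j + 1" for x j
  proof -
    have "\<bar>g (Suc (r k)) (x (r k)) j - g (Suc (r k)) (q (r k)) j\<bar> \<le> 2 * R / real (Suc (r k))" for k
    proof -
      have "g (Suc (r k)) (x (r k)) j - g (Suc (r k)) (q (r k)) j
          = (2 * R / real (Suc (r k))) * (real (x (r k) j) - real (q (r k) j))"
        by (simp add: g_def algebra_simps diff_divide_distrib del: of_nat_Suc)
      moreover have "\<bar>real (x (r k) j) - real (q (r k) j)\<bar> \<le> 1" using x[of "r k"] by auto
      ultimately show ?thesis using R
        by (simp only: abs_mult) (simp add: divide_right_mono mult_left_le del: of_nat_Suc)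
    qed
    then have "(\<lambda>k. g (Suc (r k)) (x (r k)) j - g (Suc (r k)) (q (r k)) j) \<longlonglongrightarrow> 0"
      using R by (intro tendsto_0_le[OF mesh, of _ 1] always_eventually) (auto simp: abs_of_pos)
    from tendsto_add[OF this l[OF j]] show ?thesis by simp
  qed
  have l_bound: "\<bar>l j\<bar> \<le> R" if "j < N" for j
  proof (rule LIMSEQ_le_const2[OF tendsto_rabs[OF l[OF that]]])
    have "\<bar>g (Suc (r k)) (q (r k)) j\<bar> \<le> R" for k
      using q[OF that, of "r k"] by (intro g_bound) auto
    then show "\<exists>n. \<forall>k\<ge>n. \<bar>g (Suc (r k)) (q (r k)) j\<bar> \<le> R" by blast
  qed
  show thesis
  proof (rule that[of l])
    fix i assume i: "i < N"
    have ub: "\<bar>g (Suc (r k)) (u (r k) i) j\<bar> \<le> R" "\<bar>g (Suc (r k)) (v (r k) i) j\<bar> \<le> R" if "j < N" for k j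
      using near[OF i that, of "r k"] q[OF that, of "r k"] by (auto intro!: g_bound)
    have U: "(\<lambda>k. g (Suc (r k)) (u (r k) i) j) \<longlonglongrightarrow> l j" if "j < N" for j
      using near[OF i that] by (intro close[OF that, of "\<lambda>k. u k i"]) auto
    have W: "(\<lambda>k. g (Suc (r k)) (v (r k) i) j) \<longlonglongrightarrow> l j" if "j < N" for j
      using near[OF i that] by (intro close[OF that, of "\<lambda>k. v k i"]) auto
    have "(\<lambda>k. f (g (Suc (r k)) (u (r k) i)) i) \<longlonglongrightarrow> f l i"
      using ub U i by (intro cont)
    from LIMSEQ_le[OF U[OF i] this] have "l i \<le> f l i" using sgn[OF i] by auto
    have "(\<lambda>k. f (g (Suc (r k)) (v (r k) i)) i) \<longlonglongrightarrow> f l i"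
      using ub W i by (intro cont)
    from LIMSEQ_le[OF this W[OF i]] have "f l i \<le> l i" using sgn[OF i] by auto
    with \<open>l i \<le> f l i\<close> show "f l i = l i" by simp
  qed (use l_bound in auto)
qed

text \<open>Composing with the radial retraction onto the cube of size \<open>R\<close> gives a map to which Brouwer's theorem
  applies.  A fixed point of the composition solves \<open>a = s f(a)\<close> with \<open>s = R / m\<close>, where \<open>m\<close> is the larger
  of \<open>R\<close> and the size of \<open>f(a)\<close>; if \<open>m > R\<close> it would lie on the boundary of the cube, which the
  a priori bound excludes.\<close>

lemma leray_schauder_coordinates:
  fixes f :: "(nat \<Rightarrow> real) \<Rightarrow> nat \<Rightarrow> real"
  assumes R: "R > 0"
    and cont: "\<And>a l i. (\<And>j. j < N \<Longrightarrow> (\<lambda>k. a k j) \<longlonglongrightarrow> l j) \<Longrightarrow> i < N \<Longrightarrow> (\<lambda>k. f (a k) i) \<longlonglongrightarrow> f l i"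
    and bound: "\<And>a s i. 0 \<le> s \<Longrightarrow> s \<le> 1 \<Longrightarrow> (\<And>j. j < N \<Longrightarrow> a j = s * f a j) \<Longrightarrow> i < N \<Longrightarrow> \<bar>a i\<bar> < R"
  shows "\<exists>a. \<forall>i<N. f a i = a i"
proof -
  define m where "m a = Max (insert R ((\<lambda>i. \<bar>f a i\<bar>) ` {..<N}))" for a
  have mR: "R \<le> m a" and mf: "i < N \<Longrightarrow> \<bar>f a i\<bar> \<le> m a" for a i by (auto simp: m_def)
  have m_attained: "m a = R \<or> (\<exists>i<N. m a = \<bar>f a i\<bar>)" for a
    using Max_in[of "insert R ((\<lambda>i. \<bar>f a i\<bar>) ` {..<N})"] by (auto simp: m_def)
  have m_pos: "m a > 0" for a using mR[of a] R by linarith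
  have m_cont: "(\<lambda>k. m (a k)) \<longlonglongrightarrow> m l" if "\<And>j. j < N \<Longrightarrow> (\<lambda>k. a k j) \<longlonglongrightarrow> l j" for a l
  proof -
    have "(\<lambda>k. Max (insert R ((\<lambda>i. \<bar>f (a k) i\<bar>) ` {..<n}))) \<longlonglongrightarrow> Max (insert R ((\<lambda>i. \<bar>f l i\<bar>) ` {..<n}))"
      if "n \<le> N" for n
      using that
    proof (induction n)
      case (Suc n)
      have eq: "Max (insert R ((\<lambda>i. \<bar>f b i\<bar>) ` {..<Suc n})) = max \<bar>f b n\<bar> (Max (insert R ((\<lambda>i. \<bar>f b i\<bar>) ` {..<n})))" for b
      proof -
        have "insert R ((\<lambda>i. \<bar>f b i\<bar>) ` {..<Suc n}) = insert \<bar>f b n\<bar> (insert R ((\<lambda>i. \<bar>f b i\<bar>) ` {..<n}))"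
          by (auto simp: lessThan_Suc)
        then show ?thesis by (simp only:) (rule Max_insert, auto)
      qed
      show ?case unfolding eq using Suc \<open>\<And>j. j < N \<Longrightarrow> (\<lambda>k. a k j) \<longlonglongrightarrow> l j\<close>
        by (intro tendsto_max tendsto_rabs cont) auto
    qed simp
    then show ?thesis by (simp add: m_def)
  qed
  define h where "h a i = R / m a * f a i" for a i
  have "\<bar>h a i\<bar> \<le> R" if "i < N" for a i
  proof -
    have "R * \<bar>f a i\<bar> \<le> R * m a" using mf[OF that, of a] R by simp
    then show ?thesis using m_pos[of a] R by (simp add: h_def abs_mult field_simps)
  qed
  moreover have "(\<lambda>k. h (a k) i) \<longlonglongrightarrow> h l i" if "\<And>j. j < N \<Longrightarrow> (\<lambda>k. a k j) \<longlonglongrightarrow> l j" "i < N" for a l i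
    unfolding h_def using that m_pos[of l] by (intro tendsto_intros m_cont cont) auto
  ultimately obtain a where a_le: "\<And>j. j < N \<Longrightarrow> \<bar>a j\<bar> \<le> R" and a: "\<And>i. i < N \<Longrightarrow> h a i = a i"
    by (rule brouwer_cube_coordinates[OF R, of N h]) blast+
  have small: "\<bar>a i\<bar> < R" if "i < N" for i
    using a R mR[of a] m_pos[of a] that by (intro bound[of "R / m a" a]) (auto simp: h_def)
  have "m a = R"
  proof (rule ccontr)
    assume ne: "m a \<noteq> R"
    then obtain i where i: "i < N" "m a = \<bar>f a i\<bar>" using m_attained by blast
    have "\<bar>a i\<bar> = \<bar>R / m a\<bar> * \<bar>f a i\<bar>" unfolding a[OF i(1), symmetric] h_def by (rule abs_mult)
    also have "\<dots> = R" unfolding i(2)[symmetric] using m_pos[of a] R by simp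
    finally have "\<bar>a i\<bar> = R" .
    with small[OF i(1)] show False by simp
  qed
  then have "f a i = a i" if "i < N" for i using a[OF that] R by (simp add: h_def)
  then show ?thesis by blast
qed

section \<open>Polynomial functions and separable kernels\<close>

lemma real_polynomial_function_growth:
  fixes f :: "'a::real_normed_vector \<Rightarrow> real"
  assumes "real_polynomial_function f"
  obtains C k where "C \<ge> 0" "\<And>x. \<bar>f x\<bar> \<le> C * (1 + norm x) ^ k"
proof -
  have "\<exists>C k. C \<ge> 0 \<and> (\<forall>x. \<bar>f x\<bar> \<le> C * (1 + norm x) ^ k)"
    using assms
  proof induction
    case (linear f)
    then obtain K where "K > 0" "\<And>x. norm (f x) \<le> norm x * K" using bounded_linear.pos_bounded by blast
    then have "\<bar>f x\<bar> \<le> K * (1 + norm x) ^ 1" for x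
      using \<open>K > 0\<close> by (simp add: algebra_simps add_increasing)
    with \<open>K > 0\<close> show ?case by (metis less_imp_le)
  next
    case (const c)
    show ?case by (rule exI[of _ "\<bar>c\<bar>"], rule exI[of _ 0]) simp
  next
    case (add f g)
    then obtain C k D l where f: "C \<ge> 0" "\<And>x. \<bar>f x\<bar> \<le> C * (1 + norm x) ^ k"
      and g: "D \<ge> 0" "\<And>x. \<bar>g x\<bar> \<le> D * (1 + norm x) ^ l" by metis
    have "\<bar>f x + g x\<bar> \<le> (C + D) * (1 + norm x) ^ (k + l)" for x
    proof -
      have "\<bar>f x + g x\<bar> \<le> \<bar>f x\<bar> + \<bar>g x\<bar>" by simp
      also have "\<dots> \<le> C * (1 + norm x) ^ k + D * (1 + norm x) ^ l" using f(2) g(2) by (intro add_mono)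
      also have "\<dots> \<le> C * (1 + norm x) ^ (k + l) + D * (1 + norm x) ^ (k + l)"
        using f(1) g(1) by (intro add_mono mult_left_mono power_increasing) auto
      finally show ?thesis by (simp add: algebra_simps)
    qed
    with f(1) g(1) show ?case by (metis add_nonneg_nonneg)
  next
    case (mult f g)
    then obtain C k D l where f: "C \<ge> 0" "\<And>x. \<bar>f x\<bar> \<le> C * (1 + norm x) ^ k"
      and g: "D \<ge> 0" "\<And>x. \<bar>g x\<bar> \<le> D * (1 + norm x) ^ l" by metis
    have "\<bar>f x * g x\<bar> \<le> (C * D) * (1 + norm x) ^ (k + l)" for x
    proof -
      have "\<bar>f x * g x\<bar> \<le> (C * (1 + norm x) ^ k) * (D * (1 + norm x) ^ l)"
        unfolding abs_mult using f g by (intro mult_mono) auto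
      then show ?thesis by (simp add: power_add mult_ac)
    qed
    with f(1) g(1) show ?case by (metis mult_nonneg_nonneg)
  qed
  with that show thesis by blast
qed

lemma real_polynomial_function_scaled:
  assumes "real_polynomial_function f"
  shows "real_polynomial_function (\<lambda>x. f (r *\<^sub>R x))"
  using assms
proof induction
  case (linear f)
  show ?case
    by (rule real_polynomial_function.intros(1))
       (use bounded_linear_compose[OF linear bounded_linear_scaleR_right] in \<open>simp add: o_def\<close>)
qed auto

text \<open>\<open>E\<close> is the Euler operator \<open>x \<bullet> \<nabla>\<close> applied to \<open>f\<close>.  The second estimate makes the difference quotients
  along rays dominated by a fixed power of \<open>1 + |x|\<close>, uniformly in \<open>r\<close>, so that the derivative may be
  taken under an integral.\<close>

lemma real_polynomial_function_radial_derivative: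
  fixes f :: "'a::real_normed_vector \<Rightarrow> real"
  assumes "real_polynomial_function f"
  shows "\<exists>E C k. real_polynomial_function E \<and> 0 \<le> C
      \<and> (\<forall>x. ((\<lambda>r. f (r *\<^sub>R x)) has_real_derivative E x) (at 1))
      \<and> (\<forall>x r. 0 \<le> r \<longrightarrow> r \<le> 1 \<longrightarrow> \<bar>f x - f (r *\<^sub>R x)\<bar> \<le> (1 - r) * (C * (1 + norm x) ^ k))"
  using assms
proof induction
  case (linear f)
  obtain C k where "C \<ge> 0" and b: "\<And>x. \<bar>f x\<bar> \<le> C * (1 + norm x) ^ k"
    using real_polynomial_function_growth[OF real_polynomial_function.intros(1)[OF linear]] by metis
  have s: "f (r *\<^sub>R x) = r * f x" for r x
    using linear by (simp add: bounded_linear.linear linear_scale)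
  have "\<bar>f x - f (r *\<^sub>R x)\<bar> \<le> (1 - r) * (C * (1 + norm x) ^ k)" if "r \<le> 1" for x r
  proof -
    have "f x - f (r *\<^sub>R x) = (1 - r) * f x" by (simp add: s algebra_simps)
    then show ?thesis using that b[of x] by (simp add: abs_mult mult_left_mono)
  qed
  moreover have "((\<lambda>r. f (r *\<^sub>R x)) has_real_derivative f x) (at 1)" for x
    unfolding s by (auto intro!: derivative_eq_intros)
  ultimately show ?case using \<open>C \<ge> 0\<close> real_polynomial_function.intros(1)[OF linear] by blast
next
  case (const c)
  show ?case
    by (rule exI[of _ "\<lambda>_. 0"], rule exI[of _ 0], rule exI[of _ 0]) auto
next
  case (add f g)
  obtain E C k where E: "real_polynomial_function E" "C \<ge> 0"
      "\<And>x. ((\<lambda>r. f (r *\<^sub>R x)) has_real_derivative E x) (at 1)"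
      "\<And>x r. 0 \<le> r \<Longrightarrow> r \<le> 1 \<Longrightarrow> \<bar>f x - f (r *\<^sub>R x)\<bar> \<le> (1 - r) * (C * (1 + norm x) ^ k)"
    using add.IH(1) by blast
  obtain F D l where F: "real_polynomial_function F" "D \<ge> 0"
      "\<And>x. ((\<lambda>r. g (r *\<^sub>R x)) has_real_derivative F x) (at 1)"
      "\<And>x r. 0 \<le> r \<Longrightarrow> r \<le> 1 \<Longrightarrow> \<bar>g x - g (r *\<^sub>R x)\<bar> \<le> (1 - r) * (D * (1 + norm x) ^ l)"
    using add.IH(2) by blast
  have "\<bar>(f x + g x) - (f (r *\<^sub>R x) + g (r *\<^sub>R x))\<bar> \<le> (1 - r) * ((C + D) * (1 + norm x) ^ (k + l))"
    if r: "0 \<le> r" "r \<le> 1" for x r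
  proof -
    have "\<bar>(f x + g x) - (f (r *\<^sub>R x) + g (r *\<^sub>R x))\<bar> \<le> \<bar>f x - f (r *\<^sub>R x)\<bar> + \<bar>g x - g (r *\<^sub>R x)\<bar>" by linarith
    also have "\<dots> \<le> (1 - r) * (C * (1 + norm x) ^ k) + (1 - r) * (D * (1 + norm x) ^ l)"
      using E(4) F(4) r by (intro add_mono)
    also have "\<dots> \<le> (1 - r) * (C * (1 + norm x) ^ (k + l)) + (1 - r) * (D * (1 + norm x) ^ (k + l))"
      using E(2) F(2) r by (intro add_mono mult_left_mono power_increasing) auto
    finally show ?thesis by (simp add: algebra_simps)
  qed
  moreover have "((\<lambda>r. f (r *\<^sub>R x) + g (r *\<^sub>R x)) has_real_derivative (E x + F x)) (at 1)" for x
    using E(3) F(3) by (rule DERIV_add)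
  ultimately show ?case
    by (intro exI[of _ "\<lambda>x. E x + F x"] exI[of _ "C + D"] exI[of _ "k + l"]) (use E F in auto)
next
  case (mult f g)
  obtain E C k where E: "real_polynomial_function E" "C \<ge> 0"
      "\<And>x. ((\<lambda>r. f (r *\<^sub>R x)) has_real_derivative E x) (at 1)"
      "\<And>x r. 0 \<le> r \<Longrightarrow> r \<le> 1 \<Longrightarrow> \<bar>f x - f (r *\<^sub>R x)\<bar> \<le> (1 - r) * (C * (1 + norm x) ^ k)"
    using mult.IH(1) by blast
  obtain F D l where F: "real_polynomial_function F" "D \<ge> 0"
      "\<And>x. ((\<lambda>r. g (r *\<^sub>R x)) has_real_derivative F x) (at 1)"
      "\<And>x r. 0 \<le> r \<Longrightarrow> r \<le> 1 \<Longrightarrow> \<bar>g x - g (r *\<^sub>R x)\<bar> \<le> (1 - r) * (D * (1 + norm x) ^ l)"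
    using mult.IH(2) by blast
  obtain A a where A: "A \<ge> 0" "\<And>x. \<bar>f x\<bar> \<le> A * (1 + norm x) ^ a"
    using real_polynomial_function_growth[OF mult.hyps(1)] by metis
  obtain B b where B: "B \<ge> 0" "\<And>x. \<bar>g x\<bar> \<le> B * (1 + norm x) ^ b"
    using real_polynomial_function_growth[OF mult.hyps(2)] by metis
  let ?n = "k + b + a + l"
  have "\<bar>f x * g x - f (r *\<^sub>R x) * g (r *\<^sub>R x)\<bar> \<le> (1 - r) * ((C * B + A * D) * (1 + norm x) ^ ?n)"
    if r: "0 \<le> r" "r \<le> 1" for x r
  proof -
    have le1: "(1 + norm x) ^ (k + b) \<le> (1 + norm x) ^ ?n"
      and le2: "(1 + norm x) ^ (a + l) \<le> (1 + norm x) ^ ?n" by (rule power_increasing; simp)+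
    have nr: "norm (r *\<^sub>R x) \<le> norm x" using r by (simp add: mult_left_le_one_le)
    have "\<bar>f (r *\<^sub>R x)\<bar> \<le> A * (1 + norm (r *\<^sub>R x)) ^ a" by (rule A)
    also have "\<dots> \<le> A * (1 + norm x) ^ a" using nr A(1) by (intro mult_left_mono power_mono) auto
    finally have fr: "\<bar>f (r *\<^sub>R x)\<bar> \<le> A * (1 + norm x) ^ a" .
    have "f x * g x - f (r *\<^sub>R x) * g (r *\<^sub>R x) = (f x - f (r *\<^sub>R x)) * g x + f (r *\<^sub>R x) * (g x - g (r *\<^sub>R x))"
      by (simp add: algebra_simps)
    also have "\<bar>\<dots>\<bar> \<le> \<bar>f x - f (r *\<^sub>R x)\<bar> * \<bar>g x\<bar> + \<bar>f (r *\<^sub>R x)\<bar> * \<bar>g x - g (r *\<^sub>R x)\<bar>"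
      by (metis abs_mult abs_triangle_ineq)
    also have "\<dots> \<le> ((1 - r) * (C * (1 + norm x) ^ k)) * (B * (1 + norm x) ^ b)
        + (A * (1 + norm x) ^ a) * ((1 - r) * (D * (1 + norm x) ^ l))"
      using E(2,4) F(2,4) A B r fr by (intro add_mono mult_mono) auto
    also have "\<dots> = (1 - r) * (C * B * (1 + norm x) ^ (k + b) + A * D * (1 + norm x) ^ (a + l))"
      by (simp add: power_add algebra_simps)
    also have "\<dots> \<le> (1 - r) * (C * B * (1 + norm x) ^ ?n + A * D * (1 + norm x) ^ ?n)"
      using E(2) F(2) A(1) B(1) r le1 le2 by (intro add_mono mult_left_mono le1 le2) auto
    finally show ?thesis by (simp add: algebra_simps)
  qed
  moreover have "((\<lambda>r. f (r *\<^sub>R x) * g (r *\<^sub>R x)) has_real_derivative (E x * g x + F x * f x)) (at 1)" for x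
    using DERIV_mult[OF E(3) F(3), of x] by simp
  ultimately show ?case
    by (intro exI[of _ "\<lambda>x. E x * g x + F x * f x"] exI[of _ "C * B + A * D"] exI[of _ ?n])
       (use E F A B mult.hyps in auto)
qed

definition separates :: "nat \<Rightarrow> (nat \<Rightarrow> 'a::real_normed_vector \<Rightarrow> real) \<Rightarrow> (nat \<Rightarrow> 'a \<Rightarrow> real) \<Rightarrow> ('a \<Rightarrow> 'a \<Rightarrow> real) \<Rightarrow> bool" where
  "separates N \<phi> \<eta> k \<longleftrightarrow> (\<forall>i<N. real_polynomial_function (\<phi> i) \<and> real_polynomial_function (\<eta> i))
     \<and> (\<forall>x y. k x y = (\<Sum>i<N. \<phi> i x * \<eta> i y))"

inductive separable :: "('a::real_normed_vector \<Rightarrow> 'a \<Rightarrow> real) \<Rightarrow> bool" where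
  prod: "real_polynomial_function f \<Longrightarrow> real_polynomial_function g \<Longrightarrow> separable (\<lambda>x y. f x * g y)"
| add: "separable k \<Longrightarrow> separable l \<Longrightarrow> separable (\<lambda>x y. k x y + l x y)"

lemma separable_mult:
  assumes "separable k" "separable l" shows "separable (\<lambda>x y. k x y * l x y)"
  using assms
proof (induction arbitrary: l)
  case (prod f g)
  from prod(3,1,2) show ?case
  proof induction
    case (prod f' g')
    have "separable (\<lambda>x y. (f x * f' x) * (g y * g' y))" using prod by (intro separable.prod) auto
    then show ?case by (simp add: mult_ac)
  next
    case (add k l)
    then have "separable (\<lambda>x y. f x * g y * k x y + f x * g y * l x y)" by (intro separable.add) auto
    then show ?case by (simp add: distrib_left)
  qed
next
  case (add k k')
  then have "separable (\<lambda>x y. k x y * l x y + k' x y * l x y)" by (intro separable.add) auto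
  then show ?case by (simp add: distrib_right)
qed

lemma separable_const: "separable (\<lambda>x y. c)"
  using separable.prod[OF real_polynomial_function.intros(2)[of c] real_polynomial_function.intros(2)[of 1]] by simp

lemma separable_power: "separable k \<Longrightarrow> separable (\<lambda>x y. k x y ^ n)"
  by (induction n) (auto intro: separable_const separable_mult)

lemma separable_sum: "finite I \<Longrightarrow> (\<And>i. i \<in> I \<Longrightarrow> separable (k i)) \<Longrightarrow> separable (\<lambda>x y. \<Sum>i\<in>I. k i x y)"
  by (induction rule: finite_induct) (auto intro: separable_const separable.add)

lemma sum_lessThan_add: "(\<Sum>i<m + n. f i) = (\<Sum>i<m. f i) + (\<Sum>i<n. f (m + i))" for f :: "nat \<Rightarrow> real"
  by (induction n) (auto simp: add.assoc)

lemma separable_imp_separates: "separable k \<Longrightarrow> \<exists>N \<phi> \<eta>. separates N \<phi> \<eta> k"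
proof (induction rule: separable.induct)
  case (prod f g)
  then have "separates 1 (\<lambda>_. f) (\<lambda>_. g) (\<lambda>x y. f x * g y)" by (simp add: separates_def)
  then show ?case by blast
next
  case (add k l)
  then obtain N \<phi> \<eta> M \<phi>' \<eta>' where k: "separates N \<phi> \<eta> k" and l: "separates M \<phi>' \<eta>' l" by blast
  have "separates (N + M) (\<lambda>i. if i < N then \<phi> i else \<phi>' (i - N)) (\<lambda>i. if i < N then \<eta> i else \<eta>' (i - N))
      (\<lambda>x y. k x y + l x y)"
    using k l by (auto simp: separates_def sum_lessThan_add)
  then show ?case by blast
qed

text \<open>Compare coefficients in \<open>G(-X) = G(X)\<close>.\<close>

lemma even_poly_odd_coeff:
  fixes G :: "real poly"
  assumes "\<And>r. poly G (- r) = poly G r" "odd i" shows "coeff G i = 0"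
proof -
  have "poly (pcompose G [:0, -1:]) = poly G" using assms(1) by (auto simp: poly_pcompose fun_eq_iff)
  then have "pcompose G [:0, -1:] = G" by (simp add: poly_eq_poly_eq_iff)
  then have "coeff G i = coeff (pcompose G [:0, -1:]) i" by simp
  also have "\<dots> = (-1) ^ i * coeff G i" by (simp add: coeff_pcompose_linear)
  finally show ?thesis using assms(2) by simp
qed

lemma norm_sq_eq_sum: "(norm x)\<^sup>2 = (\<Sum>b\<in>Basis. (x \<bullet> b)\<^sup>2)" for x :: "'a::euclidean_space"
  by (subst power2_norm_eq_inner, subst euclidean_inner) (simp only: power2_eq_square)

text \<open>Only even powers of \<open>|x - y|\<close> occur, and \<open>|x - y|\<^sup>2\<close> is a polynomial in the coordinates.\<close>

lemma separable_even_poly_norm_diff: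
  fixes G :: "real poly"
  assumes "\<And>r. poly G (- r) = poly G r"
  shows "separable (\<lambda>x y::'a::euclidean_space. poly G (norm (x - y)))"
proof -
  have rpf: "real_polynomial_function (\<lambda>x::'a. x \<bullet> b)" for b
    by (intro real_polynomial_function.intros(1) bounded_linear_inner_left)
  have "separable (\<lambda>x y::'a. \<Sum>b\<in>Basis. ((x - y) \<bullet> b)\<^sup>2)"
  proof (intro separable_sum separable_power)
    fix b :: 'a
    have "separable (\<lambda>x y::'a. (x \<bullet> b) * 1 + (-1) * (y \<bullet> b))"
      by (intro separable.add separable.prod rpf) auto
    then show "separable (\<lambda>x y. (x - y) \<bullet> b)" by (simp add: inner_diff_left)
  qed auto
  then have sq: "separable (\<lambda>x y::'a. (norm (x - y))\<^sup>2)" by (simp only: norm_sq_eq_sum)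
  have "separable (\<lambda>x y::'a. \<Sum>i\<le>degree G. coeff G i * norm (x - y) ^ i)"
  proof (intro separable_sum)
    fix i assume "i \<in> {..degree G}"
    show "separable (\<lambda>x y::'a. coeff G i * norm (x - y) ^ i)"
    proof (cases "even i")
      case True
      then obtain j where "i = 2 * j" by auto
      moreover have "separable (\<lambda>x y::'a. coeff G i * ((norm (x - y))\<^sup>2) ^ j)"
        by (intro separable_mult separable_const separable_power sq)
      ultimately show ?thesis by (simp add: power_mult)
    next
      case False
      then show ?thesis using even_poly_odd_coeff[OF assms] separable_const[of 0] by simp
    qed
  qed auto
  then show ?thesis by (simp add: poly_altdef)
qed

section \<open>Integrals over Euclidean space\<close>

lemma integrable_exp_neg_norm_sq:
  "integrable lborel (\<lambda>x::'a::euclidean_space. exp (- (norm x)\<^sup>2))"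
proof -
  have "has_bochner_integral lborel (\<lambda>x::real. exp (- x\<^sup>2)) (sqrt pi / 2 + sqrt pi / 2)"
    using has_bochner_integral_even_function[OF gaussian_moment_0] by simp
  then have one: "(\<integral>\<^sup>+ x. ennreal (exp (- (x::real)\<^sup>2)) \<partial>lborel) < \<infinity>"
    by (auto simp: has_bochner_integral_iff integrable_iff_bounded)
  show ?thesis
  proof (rule integrableI_nonneg)
    have "ennreal (exp (- (norm x)\<^sup>2)) = (\<Prod>b\<in>Basis. ennreal (exp (- (x \<bullet> b)\<^sup>2)))" for x :: 'a
      unfolding norm_sq_eq_sum by (simp add: prod_ennreal exp_sum sum_negf[symmetric])
    then have "(\<integral>\<^sup>+ x. ennreal (exp (- (norm (x::'a))\<^sup>2)) \<partial>lborel)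
        = (\<integral>\<^sup>+ x. (\<Prod>b\<in>Basis. ennreal (exp (- ((x::'a) \<bullet> b)\<^sup>2))) \<partial>lborel)" by simp
    also have "\<dots> = (\<Prod>b\<in>(Basis :: 'a set). \<integral>\<^sup>+ x. ennreal (exp (- (x::real)\<^sup>2)) \<partial>lborel)"
      by (rule nn_integral_lborel_prod) auto
    also have "\<dots> < \<infinity>" using one by (simp add: power_less_top_ennreal)
    finally show "(\<integral>\<^sup>+ x. ennreal (exp (- (norm (x::'a))\<^sup>2)) \<partial>lborel) < \<infinity>" .
  qed auto
qed

lemma
  fixes f :: "'a::euclidean_space \<Rightarrow> real"
  assumes f: "integrable lborel f" and c: "c > 0"
  shows integrable_lborel_scaleR: "integrable lborel (\<lambda>x. f (c *\<^sub>R x))"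
    and integral_lborel_scaleR: "(\<integral>x. f (c *\<^sub>R x) \<partial>lborel) = (\<integral>x. f x \<partial>lborel) / c ^ DIM('a)"
proof -
  have [measurable]: "f \<in> borel_measurable borel" using f by (auto dest: borel_measurable_integrable)
  have eq: "lborel = density (distr lborel borel (\<lambda>x::'a. c *\<^sub>R x)) (\<lambda>_. ennreal (c ^ DIM('a)))"
    using lborel_affine[of c "0::'a"] c by simp
  have "integrable (density (distr lborel borel (\<lambda>x::'a. c *\<^sub>R x)) (\<lambda>_. ennreal (c ^ DIM('a)))) f"
    using f eq by simp
  then have "integrable (distr lborel borel (\<lambda>x::'a. c *\<^sub>R x)) (\<lambda>x. c ^ DIM('a) *\<^sub>R f x)"
    using c by (subst (asm) integrable_density) auto
  then have "integrable (distr lborel borel (\<lambda>x::'a. c *\<^sub>R x)) f" using c by simp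
  then show "integrable lborel (\<lambda>x. f (c *\<^sub>R x))" by (subst (asm) integrable_distr_eq) auto
  have "(\<integral>x. f x \<partial>lborel)
      = (\<integral>x. f x \<partial>density (distr lborel borel (\<lambda>x::'a. c *\<^sub>R x)) (\<lambda>_. ennreal (c ^ DIM('a))))"
    using eq by simp
  also have "\<dots> = (\<integral>x. c ^ DIM('a) *\<^sub>R f x \<partial>distr lborel borel (\<lambda>x::'a. c *\<^sub>R x))"
    using c by (subst integral_density) auto
  also have "\<dots> = c ^ DIM('a) * (\<integral>x. f (c *\<^sub>R x) \<partial>lborel)"
    by (subst integral_distr) auto
  finally show "(\<integral>x. f (c *\<^sub>R x) \<partial>lborel) = (\<integral>x. f x \<partial>lborel) / c ^ DIM('a)"
    using c by simp
qed

lemma integrable_gaussian: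
  assumes "lam > 0"
  shows "integrable lborel (\<lambda>p::'a::euclidean_space. exp (- ((norm p)\<^sup>2 / 2) / lam))"
proof -
  have "(norm (sqrt (1 / (2 * lam)) *\<^sub>R p))\<^sup>2 = (norm p)\<^sup>2 / 2 / lam" for p :: 'a
    using assms by (simp add: power_mult_distrib)
  then show ?thesis
    using integrable_lborel_scaleR[OF integrable_exp_neg_norm_sq, of "sqrt (1 / (2 * lam))", where 'a='a] assms
    by simp
qed

lemma quadratic_le:
  fixes c b u :: real
  assumes "c > 0" shows "b * u - c * u\<^sup>2 \<le> b\<^sup>2 / (4 * c)"
proof -
  have sq: "(2 * c * u - b)\<^sup>2 = (c * u\<^sup>2 - b * u) * (4 * c) + b\<^sup>2"
    by (simp add: power2_eq_square algebra_simps)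
  have "0 \<le> ((c * u\<^sup>2 - b * u) * (4 * c) + b\<^sup>2) / (4 * c)"
    unfolding sq[symmetric] using assms by simp
  then show ?thesis using assms by (simp add: add_divide_distrib)
qed

text \<open>A power of \<open>1 + t\<close> is at most a multiple of \<open>exp (1 + t)\<close>, and \<open>t\<close> and \<open>t\<^sup>2\<close> are absorbed by the quartic term on
  completing the square.\<close>

lemma exp_quartic_dominates:
  fixes C2 C4 :: real
  assumes "lam > 0" "C4 > 0"
  obtains M where "M > 0" "\<And>t. t \<ge> 0 \<Longrightarrow> (1 + t) ^ k * exp (- (C4 * t ^ 4 - C2 * t ^ 2) / lam) \<le> M * exp (- t\<^sup>2)"
proof -
  define c b where "c = C4 / lam" and "b = 2 + C2 / lam"
  have c: "c > 0" using assms by (simp add: c_def)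
  have "(1 + t) ^ k * exp (- (C4 * t ^ 4 - C2 * t ^ 2) / lam) \<le> (fact k * exp (2 + b\<^sup>2 / (4 * c))) * exp (- t\<^sup>2)"
    if t: "t \<ge> 0" for t
  proof -
    have "(1 + t) ^ k / fact k \<le> exp (1 + t)"
    proof -
      have s: "(\<lambda>n. (1 + t) ^ n /\<^sub>R fact n) sums exp (1 + t)" by (rule exp_converges)
      have "(\<Sum>n\<in>{k}. (1 + t) ^ n /\<^sub>R fact n) \<le> (\<Sum>n. (1 + t) ^ n /\<^sub>R fact n)"
        by (rule sum_le_suminf) (use s t in \<open>auto simp: sums_iff\<close>)
      then show ?thesis using s by (simp add: sums_iff divide_inverse mult.commute)
    qed
    then have "(1 + t) ^ k \<le> fact k * exp (1 + t)" by (simp add: field_simps)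
    then have "(1 + t) ^ k * exp (- (C4 * t ^ 4 - C2 * t ^ 2) / lam)
        \<le> fact k * exp (1 + t) * exp (- (C4 * t ^ 4 - C2 * t ^ 2) / lam)" by (intro mult_right_mono) auto
    also have "\<dots> = fact k * exp ((1 + t) + - (C4 * t ^ 4 - C2 * t ^ 2) / lam)" by (simp only: exp_add mult.assoc)
    also have "\<dots> \<le> fact k * exp (2 + b\<^sup>2 / (4 * c) - t\<^sup>2)"
    proof (intro mult_left_mono exp_le_cancel_iff[THEN iffD2])
      have "0 \<le> (t - 1)\<^sup>2" by simp
      then have t1: "t \<le> 1 + t\<^sup>2" using t by (simp add: power2_eq_square algebra_simps)
      have "b * t\<^sup>2 - c * t ^ 4 \<le> b\<^sup>2 / (4 * c)"
        using quadratic_le[OF c, of b "t\<^sup>2"] by (simp flip: power_mult)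
      moreover have "(C4 * t ^ 4 - C2 * t ^ 2) / lam = c * t ^ 4 - b * t\<^sup>2 + 2 * t\<^sup>2"
        using assms by (simp add: c_def b_def field_simps)
      ultimately show "(1 + t) + - (C4 * t ^ 4 - C2 * t ^ 2) / lam \<le> 2 + b\<^sup>2 / (4 * c) - t\<^sup>2" using t1 by (simp only: minus_divide_left[symmetric])
    qed auto
    also have "\<dots> = (fact k * exp (2 + b\<^sup>2 / (4 * c))) * exp (- t\<^sup>2)"
      by (simp only: exp_add[symmetric] diff_conv_add_uminus mult.assoc)
    finally show ?thesis .
  qed
  then show thesis by (intro that[of "fact k * exp (2 + b\<^sup>2 / (4 * c))"]) auto
qed

lemma integral_ge_on_cball:
  fixes g :: "'a::euclidean_space \<Rightarrow> real"
  assumes g: "integrable lborel g" "\<And>x. g x \<ge> 0" and c: "\<And>x. x \<in> cball m 1 \<Longrightarrow> g x \<ge> c"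
  shows "(\<integral>x. g x \<partial>lborel) \<ge> c * measure lborel (cball 0 1 :: 'a set)"
proof -
  have "measure lborel (cball m 1) = measure lborel (cball 0 1 :: 'a set)"
    by (simp add: content_cball)
  then have "c * measure lborel (cball 0 1 :: 'a set) = (\<integral>x. c * indicator (cball m 1) x \<partial>lborel)"
    by simp
  also have "\<dots> \<le> (\<integral>x. g x \<partial>lborel)"
  proof (rule integral_mono)
    show "integrable lborel (\<lambda>x. c * indicator (cball m 1) x)"
      by (intro integrable_mult_right integrable_real_indicator) (auto simp: emeasure_cball)
    show "c * indicator (cball m 1) x \<le> g x" for x
      using g(2)[of x] c[of x] by (auto simp: indicator_def)
  qed (rule g)
  finally show ?thesis .
qed

lemma measure_unit_cball_pos: "measure lborel (cball 0 1 :: 'a::euclidean_space set) > 0"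
  by (simp add: content_cball unit_ball_vol_def)

text \<open>The convex function \<open>(1 + t)\<^sup>d\<close> lies below its chord on the unit interval.\<close>

lemma Bernoulli_upper: "0 \<le> t \<Longrightarrow> t \<le> 1 \<Longrightarrow> (1 + t) ^ d \<le> 1 + t * (2 ^ d - 1)" for t :: real
proof (induction d)
  case (Suc d)
  have "(1 + t) ^ Suc d \<le> (1 + t) * (1 + t * (2 ^ d - 1))" using Suc by simp
  also have "\<dots> = 1 + t + (t + t * t) * (2 ^ d - 1)" by (simp add: algebra_simps)
  also have "\<dots> \<le> 1 + t + (t + t) * (2 ^ d - 1)"
    using Suc.prems by (intro add_left_mono mult_right_mono) (auto simp: mult_left_le)
  finally show ?case by (simp add: algebra_simps)
qed simp

lemma has_real_derivative_imp_slope_tendsto: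
  fixes f :: "real \<Rightarrow> real"
  assumes "(f has_real_derivative D) (at 1)" "r \<longlonglongrightarrow> 1" "\<And>k. r k \<noteq> 1"
  shows "(\<lambda>k. (f 1 - f (r k)) / (1 - r k)) \<longlonglongrightarrow> D"
proof -
  have "((\<lambda>y. (f y - f 1) / (y - 1)) \<longlongrightarrow> D) (at 1)"
    using assms(1) by (simp add: has_field_derivative_iff)
  moreover have "filterlim r (at 1) sequentially"
    using assms(2,3) by (auto simp: filterlim_at)
  ultimately have "(\<lambda>k. (f (r k) - f 1) / (r k - 1)) \<longlonglongrightarrow> D"
    by (rule filterlim_compose)
  moreover have "(f (r k) - f 1) / (r k - 1) = (f 1 - f (r k)) / (1 - r k)" for k
    using minus_divide_divide[of "f (r k) - f 1" "r k - 1"] by simp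
  ultimately show ?thesis by simp
qed

section \<open>Regularity classes, gradients and product densities\<close>

lemma Ck_SucI:
  fixes f :: "'a::euclidean_space \<Rightarrow> real"
  assumes "\<And>x. (f has_derivative f' x) (at x)" "\<And>i. i \<in> Basis \<Longrightarrow> Ck k (\<lambda>x. f' x i)"
  shows "Ck (Suc k) f"
proof -
  have "frechet_derivative f (at x) = f' x" for x
    using frechet_derivative_at[OF assms(1)] by simp
  moreover have "f differentiable_on UNIV"
    using assms(1) by (auto simp: differentiable_on_def differentiable_def)
  ultimately show ?thesis using assms(2) by simp
qed

lemma Ck_SucD:
  fixes f :: "'a::euclidean_space \<Rightarrow> real"
  assumes "Ck (Suc k) f"
  shows "(f has_derivative frechet_derivative f (at x)) (at x)"
    and "i \<in> Basis \<Longrightarrow> Ck k (\<lambda>x. frechet_derivative f (at x) i)"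
  using assms by (auto simp: differentiable_on_def frechet_derivative_works[symmetric])

lemma Ck_lower: "Ck (Suc k) f \<Longrightarrow> Ck k f" for f :: "'a::euclidean_space \<Rightarrow> real"
proof (induction k arbitrary: f)
  case 0
  then show ?case by (auto intro: differentiable_imp_continuous_on)
next
  case (Suc k)
  show ?case
    by (rule Ck_SucI[OF Ck_SucD(1)[OF Suc.prems] Suc.IH[OF Ck_SucD(2)[OF Suc.prems]]])
qed

lemma Ck_const: "Ck k (\<lambda>x::'a::euclidean_space. c)"
  by (induction k arbitrary: c) (auto intro: Ck_SucI[where f' = "\<lambda>x i. 0"])

lemma Ck_add: "Ck k f \<Longrightarrow> Ck k g \<Longrightarrow> Ck k (\<lambda>x. f x + g x)" for f g :: "'a::euclidean_space \<Rightarrow> real"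
proof (induction k arbitrary: f g)
  case 0
  then show ?case by (simp add: continuous_on_add)
next
  case (Suc k)
  show ?case
    by (rule Ck_SucI[OF has_derivative_add[OF Ck_SucD(1)[OF Suc.prems(1)] Ck_SucD(1)[OF Suc.prems(2)]]])
       (intro Suc.IH Ck_SucD(2)[OF Suc.prems(1)] Ck_SucD(2)[OF Suc.prems(2)])
qed

lemma Ck_mult: "Ck k f \<Longrightarrow> Ck k g \<Longrightarrow> Ck k (\<lambda>x. f x * g x)" for f g :: "'a::euclidean_space \<Rightarrow> real"
proof (induction k arbitrary: f g)
  case 0
  then show ?case by (simp add: continuous_on_mult)
next
  case (Suc k)
  show ?case
    by (rule Ck_SucI[OF has_derivative_mult[OF Ck_SucD(1)[OF Suc.prems(1)] Ck_SucD(1)[OF Suc.prems(2)]]])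
       (intro Ck_add Suc.IH Ck_SucD(2)[OF Suc.prems(1)] Ck_SucD(2)[OF Suc.prems(2)]
          Ck_lower[OF Suc.prems(1)] Ck_lower[OF Suc.prems(2)])
qed

lemma Ck_exp: "Ck k f \<Longrightarrow> Ck k (\<lambda>x. exp (f x))" for f :: "'a::euclidean_space \<Rightarrow> real"
proof (induction k arbitrary: f)
  case 0
  then show ?case by (simp add: continuous_on_exp)
next
  case (Suc k)
  show ?case
    by (rule Ck_SucI[OF has_derivative_exp[OF Ck_SucD(1)[OF Suc.prems]]])
       (intro Ck_mult Ck_SucD(2)[OF Suc.prems] Suc.IH[OF Ck_lower[OF Suc.prems]])
qed

lemma Ck_bounded_linear: "bounded_linear f \<Longrightarrow> Ck k f" for f :: "'a::euclidean_space \<Rightarrow> real"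
proof (cases k)
  case (Suc n)
  assume "bounded_linear f"
  then show ?thesis
    unfolding Suc by (rule Ck_SucI[OF bounded_linear_imp_has_derivative Ck_const])
qed (simp add: linear_continuous_on)

lemma Ck_real_polynomial_function: "real_polynomial_function f \<Longrightarrow> Ck k f" for f :: "'a::euclidean_space \<Rightarrow> real"
  by (induction rule: real_polynomial_function.induct) (auto intro: Ck_bounded_linear Ck_const Ck_add Ck_mult)

text \<open>A basis vector of the product space has first component either zero or a basis vector, so the partial
  derivatives are either zero or of the same form.\<close>

lemma Ck_fst: "Ck k f \<Longrightarrow> Ck k (\<lambda>z::'a \<times> 'b::euclidean_space. f (fst z))"
  for f :: "'a::euclidean_space \<Rightarrow> real"
proof (induction k arbitrary: f)
  case 0
  then show ?case by (auto intro: continuous_on_compose2[OF _ continuous_on_fst] continuous_intros)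
next
  case (Suc k)
  have "((\<lambda>z::'a \<times> 'b. f (fst z)) has_derivative (\<lambda>v. frechet_derivative f (at (fst z)) (fst v))) (at z)" for z
    by (rule has_derivative_compose[OF has_derivative_fst[OF has_derivative_ident] Ck_SucD(1)[OF Suc.prems]])
  then show ?case
  proof (rule Ck_SucI)
    fix i :: "'a \<times> 'b" assume i: "i \<in> Basis"
    show "Ck k (\<lambda>z::'a \<times> 'b. frechet_derivative f (at (fst z)) (fst i))"
    proof (cases "fst i = 0")
      case True
      have "frechet_derivative f (at x) 0 = 0" for x
        using Ck_SucD(1)[OF Suc.prems, of x] by (simp add: has_derivative_linear linear_0)
      then show ?thesis using True by (simp add: Ck_const)
    next
      case False
      then have "fst i \<in> Basis" using i by (auto simp: Basis_prod_def)
      then show ?thesis by (intro Suc.IH[of "\<lambda>x. frechet_derivative f (at x) (fst i)"] Ck_SucD(2)[OF Suc.prems])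
    qed
  qed
qed

lemma grad_eqI:
  fixes g :: "'a::euclidean_space"
  assumes "(f has_derivative (\<lambda>v. g \<bullet> v)) (at x)"
  shows "grad f x = g"
proof -
  have "frechet_derivative f (at x) = (\<lambda>v. g \<bullet> v)" using frechet_derivative_at[OF assms] by simp
  then show ?thesis by (simp add: grad_def euclidean_representation)
qed

lemma has_derivative_grad:
  fixes f :: "'a::euclidean_space \<Rightarrow> real"
  assumes "f differentiable (at x)"
  shows "(f has_derivative (\<lambda>v. grad f x \<bullet> v)) (at x)"
proof -
  let ?D = "frechet_derivative f (at x)"
  have D: "(f has_derivative ?D) (at x)" using assms by (simp add: frechet_derivative_works)
  have lin: "linear ?D" using D by (rule has_derivative_linear)
  have "?D v = grad f x \<bullet> v" for v
  proof -
    have "?D v = ?D (\<Sum>i\<in>Basis. (v \<bullet> i) *\<^sub>R i)" by (simp add: euclidean_representation)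
    also have "\<dots> = (\<Sum>i\<in>Basis. (v \<bullet> i) * ?D i)" by (simp add: linear_sum[OF lin] linear_scale[OF lin])
    also have "\<dots> = grad f x \<bullet> v" by (simp add: grad_def inner_sum_left inner_commute[of v] mult.commute)
    finally show ?thesis .
  qed
  then have "?D = (\<lambda>v. grad f x \<bullet> v)" by auto
  with D show ?thesis by simp
qed

lemma divergence_eqI:
  "(F has_derivative D) (at x) \<Longrightarrow> divergence F x = (\<Sum>i\<in>Basis. D i \<bullet> i)"
  using frechet_derivative_at[of F D x] by (simp add: divergence_def)

text \<open>Fubini's theorem for a product of a vector-valued function of the first variable and a scalar function of
  the second; absolute integrability is immediate because the norm is a product as well.\<close>

lemma has_bochner_integral_lborel_tensor:
  fixes f :: "'a::euclidean_space \<Rightarrow> 'c::euclidean_space" and g :: "'b::euclidean_space \<Rightarrow> real"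
  assumes f: "integrable lborel f" and g: "integrable lborel g"
  shows "has_bochner_integral lborel (\<lambda>z. g (snd z) *\<^sub>R f (fst z)) ((\<integral>y. g y \<partial>lborel) *\<^sub>R (\<integral>x. f x \<partial>lborel))"
proof -
  have [measurable]: "f \<in> borel_measurable borel" "g \<in> borel_measurable borel"
    using f g by (auto dest: borel_measurable_integrable)
  have int: "integrable (lborel \<Otimes>\<^sub>M lborel) (\<lambda>z. g (snd z) *\<^sub>R f (fst z))"
  proof (rule lborel_pair.Fubini_integrable)
    show "(\<lambda>z. g (snd z) *\<^sub>R f (fst z)) \<in> borel_measurable (lborel \<Otimes>\<^sub>M lborel)" by measurable
    have "(\<lambda>x. \<integral>y. norm (g (snd (x, y)) *\<^sub>R f (fst (x, y))) \<partial>lborel) = (\<lambda>x. (\<integral>y. \<bar>g y\<bar> \<partial>lborel) * norm (f x))"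
      by simp
    then show "integrable lborel (\<lambda>x. \<integral>y. norm (g (snd (x, y)) *\<^sub>R f (fst (x, y))) \<partial>lborel)"
      using f by simp
    show "AE x in lborel. integrable lborel (\<lambda>y. g (snd (x, y)) *\<^sub>R f (fst (x, y)))"
      using g by simp
  qed
  have "(\<integral>z. g (snd z) *\<^sub>R f (fst z) \<partial>(lborel \<Otimes>\<^sub>M lborel)) = (\<integral>x. \<integral>y. g y *\<^sub>R f x \<partial>lborel \<partial>lborel)"
    using lborel_pair.integral_fst'[OF int] by simp
  also have "\<dots> = (\<integral>y. g y \<partial>lborel) *\<^sub>R (\<integral>x. f x \<partial>lborel)"
    using g f by simp
  finally show ?thesis using int by (simp add: has_bochner_integral_iff lborel_prod)
qed

section \<open>Gibbs weights of a polynomial mean field\<close>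

text \<open>What the existence argument uses of the two potentials.  \<open>V_radial\<close> is semiconvexity of \<open>V\<close> along rays
  from the origin, with the derivative at the end point \<open>x\<close> replaced by a difference quotient, so that the
  growth of the gradient of \<open>V\<close> never enters.  In \<open>psi_radial\<close> the number \<open>D z\<close> is
  \<open>z \<bullet> \<nabla>\<psi>(z)\<close>.\<close>

locale mean_field =
  fixes V \<psi> :: "'a::euclidean_space \<Rightarrow> real" and lam C2 C4 B K :: real
    and N :: nat and \<phi> \<eta> :: "nat \<Rightarrow> 'a \<Rightarrow> real"
  assumes lam: "lam > 0"
    and V_cont: "continuous_on UNIV V"
    and C4: "C4 > 0" and V_lower: "\<And>x. V x \<ge> C4 * norm x ^ 4 - C2 * norm x ^ 2"
    and V_radial: "\<And>x r. 0 \<le> r \<Longrightarrow> r \<le> 1 \<Longrightarrow> V x - V (r *\<^sub>R x) \<ge> (1 - r) * (V x - V 0 - B * (norm x)\<^sup>2)"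
    and psi_nonneg: "\<And>z. \<psi> z \<ge> 0"
    and psi_even: "\<And>z. \<psi> (- z) = \<psi> z"
    and psi_radial: "\<And>z. \<exists>D. (\<psi> has_derivative D) (at z) \<and> D z \<ge> \<psi> z"
    and psi_shift: "\<And>z h. norm h \<le> 1 \<Longrightarrow> \<psi> (z + h) \<le> K * (1 + \<psi> z)" and K: "K \<ge> 0"
    and sep: "separates N \<phi> \<eta> (\<lambda>x y. \<psi> (x - y))"
begin

text \<open>The trial potential with coefficients \<open>a\<close>.\<close>

definition P :: "(nat \<Rightarrow> real) \<Rightarrow> 'a \<Rightarrow> real" where
  "P a x = (\<Sum>i<N. a i * \<phi> i x)"

text \<open>For arbitrary coefficients \<open>P a\<close> may tend to minus infinity faster than \<open>V\<close> grows.  Its positive part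
  keeps the weight below \<open>exp (-V / lam)\<close>, and changes nothing at the solutions of \<open>a = s M(a)\<close>, where
  \<open>P a = s (\<psi> \<ast> u) \<ge> 0\<close>.\<close>

definition w :: "(nat \<Rightarrow> real) \<Rightarrow> 'a \<Rightarrow> real" where
  "w a x = exp (- (V x + max 0 (P a x)) / lam)"

definition Z :: "(nat \<Rightarrow> real) \<Rightarrow> real" where
  "Z a = (\<integral>x. w a x \<partial>lborel)"

definition M :: "(nat \<Rightarrow> real) \<Rightarrow> nat \<Rightarrow> real" where
  "M a i = (\<integral>x. \<eta> i x * w a x \<partial>lborel) / Z a"

lemma phi: "i < N \<Longrightarrow> real_polynomial_function (\<phi> i)"
  and eta: "i < N \<Longrightarrow> real_polynomial_function (\<eta> i)"
  and psi_eq: "\<psi> (x - y) = (\<Sum>i<N. \<phi> i x * \<eta> i y)"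
  using sep by (auto simp: separates_def)

lemma P_poly: "real_polynomial_function (P a)"
  unfolding P_def using phi by (intro real_polynomial_function_sum) auto

lemma cont_poly: "real_polynomial_function f \<Longrightarrow> continuous_on UNIV f" for f :: "'a \<Rightarrow> real"
  by (simp add: continuous_at_imp_continuous_on continuous_real_polymonial_function)

lemma borel_poly: "real_polynomial_function f \<Longrightarrow> f \<in> borel_measurable borel" for f :: "'a \<Rightarrow> real"
  by (intro borel_measurable_continuous_onI cont_poly)

lemma borel_V[measurable]: "V \<in> borel_measurable borel"
  by (intro borel_measurable_continuous_onI V_cont)

lemma borel_P[measurable]: "P a \<in> borel_measurable borel"
  by (intro borel_poly P_poly)

lemma borel_w[measurable]: "w a \<in> borel_measurable borel"
  unfolding w_def by measurable

lemma w_pos: "w a x > 0" and w_le: "w a x \<le> exp (- V x / lam)"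
proof -
  have "- (V x + max 0 (P a x)) / lam \<le> - V x / lam" using lam by (intro divide_right_mono) auto
  then show "w a x \<le> exp (- V x / lam)" by (simp add: w_def)
qed (simp add: w_def)

lemma integrable_poly_exp_V:
  assumes f: "real_polynomial_function f"
  shows "integrable lborel (\<lambda>x. f x * exp (- V x / lam))"
proof -
  obtain C k where C: "C \<ge> 0" "\<And>x. \<bar>f x\<bar> \<le> C * (1 + norm x) ^ k"
    using real_polynomial_function_growth[OF f] by blast
  obtain m where m: "m > 0" "\<And>t. t \<ge> 0 \<Longrightarrow> (1 + t) ^ k * exp (- (C4 * t ^ 4 - C2 * t ^ 2) / lam) \<le> m * exp (- t\<^sup>2)"
    using exp_quartic_dominates[OF lam C4] by blast
  have [measurable]: "f \<in> borel_measurable borel" using f by (rule borel_poly)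
  show ?thesis
  proof (rule Bochner_Integration.integrable_bound)
    show "integrable lborel (\<lambda>x::'a. C * m * exp (- (norm x)\<^sup>2))"
      by (intro integrable_mult_right integrable_exp_neg_norm_sq)
    show "AE x in lborel. norm (f x * exp (- V x / lam)) \<le> norm (C * m * exp (- (norm x)\<^sup>2))"
    proof (rule AE_I2)
      fix x
      have "\<bar>f x\<bar> * exp (- V x / lam) \<le> (C * (1 + norm x) ^ k) * exp (- (C4 * norm x ^ 4 - C2 * norm x ^ 2) / lam)"
        using C V_lower[of x] lam by (intro mult_mono exp_le_cancel_iff[THEN iffD2] divide_right_mono) auto
      also have "\<dots> \<le> C * (m * exp (- (norm x)\<^sup>2))"
        using m(2)[of "norm x"] C(1) by (simp add: mult.assoc mult_left_mono)
      finally show "norm (f x * exp (- V x / lam)) \<le> norm (C * m * exp (- (norm x)\<^sup>2))"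
        using C(1) m(1) by (simp add: abs_mult mult.assoc)
    qed
  qed measurable
qed

lemma integrable_poly_w:
  assumes f: "real_polynomial_function f"
  shows "integrable lborel (\<lambda>x. f x * w a x)"
proof (rule Bochner_Integration.integrable_bound[OF integrable_poly_exp_V[OF f]])
  have [measurable]: "f \<in> borel_measurable borel" using f by (rule borel_poly)
  show "(\<lambda>x. f x * w a x) \<in> borel_measurable lborel" by measurable
  show "AE x in lborel. norm (f x * w a x) \<le> norm (f x * exp (- V x / lam))"
    using w_le[of a] w_pos[of a] by (intro AE_I2) (auto simp: abs_mult less_imp_le intro!: mult_left_mono)
qed

lemma integrable_w: "integrable lborel (w a)"
  using integrable_poly_w[OF real_polynomial_function.intros(2)[of 1]] by simp

lemma Z_pos: "Z a > 0"
proof -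
  have "continuous_on (cball 0 1) (w a)"
    unfolding w_def using lam
    by (intro continuous_intros continuous_on_subset[OF V_cont] continuous_on_subset[OF cont_poly[OF P_poly]]) auto
  then obtain x where x: "\<And>y. y \<in> cball 0 1 \<Longrightarrow> w a x \<le> w a y"
    using continuous_attains_inf[of "cball 0 1" "w a"] by fastforce
  have "0 < w a x * measure lborel (cball 0 1 :: 'a set)"
    using w_pos measure_unit_cball_pos by (intro mult_pos_pos)
  also have "\<dots> \<le> Z a"
    unfolding Z_def using x
    by (intro integral_ge_on_cball[OF integrable_w, where m = 0]) (auto simp: w_pos less_imp_le)
  finally show ?thesis .
qed

lemma P_cont: "(\<And>j. j < N \<Longrightarrow> (\<lambda>k. a k j) \<longlonglongrightarrow> l j) \<Longrightarrow> (\<lambda>k. P (a k) x) \<longlonglongrightarrow> P l x"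
  unfolding P_def by (intro tendsto_sum tendsto_mult tendsto_const) auto

lemma w_cont: "(\<And>j. j < N \<Longrightarrow> (\<lambda>k. a k j) \<longlonglongrightarrow> l j) \<Longrightarrow> (\<lambda>k. w (a k) x) \<longlonglongrightarrow> w l x"
  unfolding w_def using lam by (intro tendsto_intros P_cont) auto

lemma integral_poly_w_cont:
  assumes f: "real_polynomial_function f" and a: "\<And>j. j < N \<Longrightarrow> (\<lambda>k. a k j) \<longlonglongrightarrow> l j"
  shows "(\<lambda>k. \<integral>x. f x * w (a k) x \<partial>lborel) \<longlonglongrightarrow> (\<integral>x. f x * w l x \<partial>lborel)"
proof (rule integral_dominated_convergence[where w = "\<lambda>x. \<bar>f x * exp (- V x / lam)\<bar>"])
  have [measurable]: "f \<in> borel_measurable borel" using f by (rule borel_poly)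
  show "(\<lambda>x. f x * w l x) \<in> borel_measurable lborel" by measurable
  show "(\<lambda>x. f x * w (a k) x) \<in> borel_measurable lborel" for k by measurable
  show "integrable lborel (\<lambda>x. \<bar>f x * exp (- V x / lam)\<bar>)"
    using integrable_poly_exp_V[OF f] by (rule integrable_abs)
  show "AE x in lborel. (\<lambda>k. f x * w (a k) x) \<longlonglongrightarrow> f x * w l x"
    by (intro AE_I2 tendsto_mult tendsto_const w_cont a)
  show "AE x in lborel. norm (f x * w (a k) x) \<le> \<bar>f x * exp (- V x / lam)\<bar>" for k
    using w_le[of "a k"] w_pos[of "a k"] by (intro AE_I2) (auto simp: abs_mult less_imp_le intro!: mult_left_mono)
qed

lemma M_cont:
  assumes "\<And>j. j < N \<Longrightarrow> (\<lambda>k. a k j) \<longlonglongrightarrow> l j" "i < N"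
  shows "(\<lambda>k. M (a k) i) \<longlonglongrightarrow> M l i"
proof -
  have "(\<lambda>k. Z (a k)) \<longlonglongrightarrow> Z l"
    using integral_poly_w_cont[OF real_polynomial_function.intros(2)[of 1] assms(1)] by (simp add: Z_def)
  then show ?thesis
    unfolding M_def using integral_poly_w_cont[OF eta[OF assms(2)] assms(1)] Z_pos[of l]
    by (intro tendsto_divide) auto
qed

lemma integrable_psi_w: "integrable lborel (\<lambda>y. \<psi> (x - y) * w a y)"
  unfolding psi_eq sum_distrib_right
proof (rule Bochner_Integration.integrable_sum)
  fix i assume "i \<in> {..<N}"
  then show "integrable lborel (\<lambda>y. \<phi> i x * \<eta> i y * w a y)"
    using integrable_mult_right[OF integrable_poly_w[OF eta, of i a], of "\<phi> i x"] by (simp add: mult.assoc)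
qed

lemma integral_lincomb_w:
  assumes "\<And>i. i < N \<Longrightarrow> real_polynomial_function (g i)"
  shows "(\<integral>x. (\<Sum>i<N. c i * g i x) * w a x \<partial>lborel) = (\<Sum>i<N. c i * (\<integral>x. g i x * w a x \<partial>lborel))"
proof -
  have "(\<integral>x. (\<Sum>i<N. c i * g i x) * w a x \<partial>lborel) = (\<integral>x. (\<Sum>i<N. c i * (g i x * w a x)) \<partial>lborel)"
    by (simp add: sum_distrib_right sum_distrib_left mult_ac)
  also have "\<dots> = (\<Sum>i<N. c i * (\<integral>x. g i x * w a x \<partial>lborel))"
    using integrable_poly_w[OF assms] by (subst Bochner_Integration.integral_sum) auto
  finally show ?thesis .
qed

text \<open>The moments of the normalised weight are the coefficients of its convolution with \<open>\<psi>\<close>.\<close>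

lemma P_moments: "(\<Sum>i<N. M a i * \<phi> i x) = (\<integral>y. \<psi> (x - y) * w a y \<partial>lborel) / Z a"
proof -
  have "(\<integral>y. \<psi> (x - y) * w a y \<partial>lborel) = (\<Sum>i<N. \<phi> i x * (\<integral>y. \<eta> i y * w a y \<partial>lborel))"
    unfolding psi_eq by (rule integral_lincomb_w) (rule eta)
  then show ?thesis by (simp add: M_def sum_divide_distrib mult.commute)
qed

lemma poly_norm_sq: "real_polynomial_function (\<lambda>x::'a. (norm x)\<^sup>2)"
proof -
  have "real_polynomial_function (\<lambda>x::'a. \<Sum>b\<in>Basis. (x \<bullet> b)\<^sup>2)"
    by (intro real_polynomial_function_sum real_polynomial_function_power real_polynomial_function.intros(1)
        bounded_linear_inner_left finite_Basis)
  then show ?thesis by (simp only: norm_sq_eq_sum)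
qed

definition c0 :: real where "c0 = V 0 + (C2 + B + 1)\<^sup>2 / (4 * C4)"

lemma V_radial_quadratic:
  assumes "0 \<le> r" "r \<le> 1"
  shows "V x - V (r *\<^sub>R x) \<ge> (1 - r) * ((norm x)\<^sup>2 - c0)"
proof -
  let ?t = "(norm x)\<^sup>2" and ?b = "C2 + B + 1"
  have "?b * ?t - C4 * norm x ^ 4 \<le> ?b\<^sup>2 / (4 * C4)"
    using quadratic_le[OF C4, of ?b ?t] by (simp flip: power_mult)
  then have "?t - c0 \<le> V x - V 0 - B * ?t"
    using V_lower[of x] by (simp add: c0_def algebra_simps)
  then have "(1 - r) * (?t - c0) \<le> (1 - r) * (V x - V 0 - B * ?t)" using assms by (intro mult_left_mono) auto
  with V_radial[OF assms, of x] show ?thesis by linarith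
qed

text \<open>Write \<open>U = (V + P a) / lam\<close>.  The integral of \<open>w a (r x)\<close> is \<open>Z a / r\<^sup>d\<close>, while pointwise
  \<open>exp (-U(r x)) = exp (-U(x)) exp (U(x) - U(r x)) \<ge> exp (-U(x)) (1 + U(x) - U(r x))\<close>.
  This replaces an integration by parts, in which the gradient of \<open>V\<close> would have to be controlled.\<close>

lemma scaling_inequality:
  assumes nonneg: "\<And>x. P a x \<ge> 0" and r: "0 < r" "r < 1"
  shows "(\<integral>x. ((norm x)\<^sup>2 - c0 + (P a x - P a (r *\<^sub>R x)) / (1 - r)) * w a x \<partial>lborel)
      \<le> lam * ((1 / r ^ DIM('a) - 1) / (1 - r)) * Z a"
proof -
  define q where "q x = (norm x)\<^sup>2 - c0 + (P a x - P a (r *\<^sub>R x)) / (1 - r)" for x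
  have q: "real_polynomial_function q" unfolding q_def
    by (intro real_polynomial_function_diff real_polynomial_function_divide real_polynomial_function.intros(2,3)
        poly_norm_sq P_poly real_polynomial_function_scaled)
  have le: "w a x + (1 - r) / lam * (q x * w a x) \<le> w a (r *\<^sub>R x)" for x
  proof -
    let ?D = "(V x - V (r *\<^sub>R x) + (P a x - P a (r *\<^sub>R x))) / lam"
    have "(1 - r) * q x = (1 - r) * ((norm x)\<^sup>2 - c0) + (P a x - P a (r *\<^sub>R x))"
      using r by (simp add: q_def distrib_left)
    also have "\<dots> \<le> V x - V (r *\<^sub>R x) + (P a x - P a (r *\<^sub>R x))"
      using V_radial_quadratic[of r x] r by simp
    finally have "(1 - r) * q x / lam \<le> ?D" using lam by (intro divide_right_mono) auto
    then have "1 + (1 - r) * q x / lam \<le> exp ?D" using exp_ge_add_one_self[of ?D] by linarith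
    then have "w a x * (1 + (1 - r) * q x / lam) \<le> w a x * exp ?D"
      using w_pos[of a x] by (intro mult_left_mono) auto
    also have "w a x * exp ?D = w a (r *\<^sub>R x)"
    proof -
      have "- (V x + P a x) / lam + ?D = - (V (r *\<^sub>R x) + P a (r *\<^sub>R x)) / lam"
        by (simp add: add_divide_distrib diff_divide_distrib)
      then show ?thesis using nonneg by (simp add: w_def max_def exp_add[symmetric] del: minus_add_distrib)
    qed
    finally show ?thesis by (simp add: distrib_left mult_ac)
  qed
  have "Z a + (1 - r) / lam * (\<integral>x. q x * w a x \<partial>lborel)
      = (\<integral>x. w a x + (1 - r) / lam * (q x * w a x) \<partial>lborel)"
    unfolding Z_def
    by (subst Bochner_Integration.integral_add)
       (auto intro!: integrable_w integrable_mult_right integrable_poly_w[OF q] simp del: times_divide_eq_left)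
  also have "\<dots> \<le> (\<integral>x. w a (r *\<^sub>R x) \<partial>lborel)"
    by (intro integral_mono le Bochner_Integration.integrable_add integrable_w integrable_mult_right
        integrable_poly_w[OF q] integrable_lborel_scaleR r)
  also have "\<dots> = Z a / r ^ DIM('a)"
    unfolding Z_def by (rule integral_lborel_scaleR[OF integrable_w r(1)])
  finally have "(1 - r) / lam * (\<integral>x. q x * w a x \<partial>lborel) \<le> (1 / r ^ DIM('a) - 1) * Z a"
    by (simp add: algebra_simps)
  then have "(\<integral>x. q x * w a x \<partial>lborel) \<le> lam * ((1 / r ^ DIM('a) - 1) / (1 - r)) * Z a"
    using r lam by (simp add: field_simps)
  then show ?thesis unfolding q_def .
qed

lemma slope_factor_bound:
  assumes t: "0 < t" "t \<le> (1::real)"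
  shows "(1 / (1 / (1 + t)) ^ d - 1) / (1 - 1 / (1 + t)) \<le> 2 * 2 ^ d"
proof -
  have "(1 / (1 / (1 + t)) ^ d - 1) / (1 - 1 / (1 + t)) = ((1 + t) ^ d - 1) * (1 + t) / t"
    using t by (simp add: power_one_over field_simps)
  also have "\<dots> \<le> (t * (2 ^ d - 1)) * 2 / t"
    using Bernoulli_upper[of t d] t by (intro divide_right_mono mult_mono) auto
  also have "\<dots> \<le> 2 * 2 ^ d" using t by simp
  finally show ?thesis .
qed

text \<open>The limit \<open>r \<rightarrow> 1\<close> of the scaling inequality.  The difference quotients of the polynomial \<open>P a\<close> along rays
  are dominated by a polynomial, so they may be replaced by \<open>E = x \<bullet> \<nabla>(P a)\<close> under the integral.\<close>

lemma virial_inequality: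
  assumes nonneg: "\<And>x. P a x \<ge> 0"
    and E: "real_polynomial_function E" "\<And>x. ((\<lambda>r. P a (r *\<^sub>R x)) has_real_derivative E x) (at 1)"
  shows "(\<integral>x. ((norm x)\<^sup>2 - c0 + E x) * w a x \<partial>lborel) \<le> lam * (2 * 2 ^ DIM('a)) * Z a"
proof -
  obtain C m where C: "C \<ge> 0" and slope: "\<forall>x r. 0 \<le> r \<longrightarrow> r \<le> 1 \<longrightarrow>
      \<bar>P a x - P a (r *\<^sub>R x)\<bar> \<le> (1 - r) * (C * (1 + norm x) ^ m)"
    using real_polynomial_function_radial_derivative[OF P_poly[of a]] by blast
  \<comment> \<open>Scalings of the form \<open>1 / (1 + t)\<close> with \<open>t \<le> 1\<close>, for which \<open>slope_factor_bound\<close> applies.\<close>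
  define r where "r k = 1 / (1 + 1 / real (Suc k))" for k
  have r: "0 < r k" "r k < 1" for k by (auto simp: r_def field_simps)
  have "(\<lambda>k. 1 / (1 + 1 / real (Suc k))) \<longlonglongrightarrow> 1 / (1 + 0)"
    by (intro tendsto_intros LIMSEQ_Suc[OF lim_const_over_n]) auto
  then have r1: "r \<longlonglongrightarrow> 1" by (simp add: r_def[abs_def])
  let ?q = "\<lambda>k x. (norm x)\<^sup>2 - c0 + (P a x - P a (r k *\<^sub>R x)) / (1 - r k)"
  let ?b = "\<lambda>x::'a. (norm x)\<^sup>2 + \<bar>c0\<bar> + C * (2 * (1 + (norm x)\<^sup>2)) ^ m"
  have q: "real_polynomial_function (?q k)" for k
    by (intro real_polynomial_function_diff real_polynomial_function_divide real_polynomial_function.intros(2,3)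
        poly_norm_sq P_poly real_polynomial_function_scaled)
  have b: "real_polynomial_function ?b"
    by (intro real_polynomial_function.intros(2,3,4) real_polynomial_function_power[where n = m] poly_norm_sq)
  have lim: "real_polynomial_function (\<lambda>x. (norm x)\<^sup>2 - c0 + E x)"
    by (intro real_polynomial_function.intros(2,3) real_polynomial_function_diff poly_norm_sq E(1))
  have qb: "\<bar>?q k x\<bar> \<le> ?b x" for k x
  proof -
    have "\<bar>(P a x - P a (r k *\<^sub>R x)) / (1 - r k)\<bar> \<le> C * (1 + norm x) ^ m"
      using slope[rule_format, of "r k" x] r[of k] by (simp add: field_simps)
    also have "\<dots> \<le> C * (2 * (1 + (norm x)\<^sup>2)) ^ m"
    proof -
      have "0 \<le> (norm x - 1)\<^sup>2 + (norm x)\<^sup>2" by simp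
      then have "1 + norm x \<le> 2 * (1 + (norm x)\<^sup>2)"
        by (simp add: power2_eq_square algebra_simps) (use norm_ge_zero[of x] in linarith)
      then show ?thesis using C by (intro mult_left_mono power_mono) auto
    qed
    finally show ?thesis using zero_le_power2[of "norm x"] by linarith
  qed
  have "(\<lambda>k. \<integral>x. ?q k x * w a x \<partial>lborel) \<longlonglongrightarrow> (\<integral>x. ((norm x)\<^sup>2 - c0 + E x) * w a x \<partial>lborel)"
  proof (rule integral_dominated_convergence[where w = "\<lambda>x. ?b x * w a x"])
    show "(\<lambda>x. ((norm x)\<^sup>2 - c0 + E x) * w a x) \<in> borel_measurable lborel"
      using integrable_poly_w[OF lim] by (rule borel_measurable_integrable)
    show "(\<lambda>x. ?q k x * w a x) \<in> borel_measurable lborel" for k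
      using integrable_poly_w[OF q] by (rule borel_measurable_integrable)
    show "integrable lborel (\<lambda>x. ?b x * w a x)" by (rule integrable_poly_w[OF b])
    show "AE x in lborel. (\<lambda>k. ?q k x * w a x) \<longlonglongrightarrow> ((norm x)\<^sup>2 - c0 + E x) * w a x"
    proof (intro AE_I2 tendsto_mult tendsto_add tendsto_const)
      fix x
      show "(\<lambda>k. (P a x - P a (r k *\<^sub>R x)) / (1 - r k)) \<longlonglongrightarrow> E x"
        using has_real_derivative_imp_slope_tendsto[OF E(2) r1, of x] r(2) by (simp add: less_imp_neq)
    qed
    show "AE x in lborel. norm (?q k x * w a x) \<le> ?b x * w a x" for k
      using qb[where k = k] w_pos[of a] by (intro AE_I2) (auto simp: abs_mult less_imp_le intro!: mult_right_mono)
  qed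
  moreover have "(\<integral>x. ?q k x * w a x \<partial>lborel) \<le> lam * (2 * 2 ^ DIM('a)) * Z a" for k
  proof -
    have "(\<integral>x. ?q k x * w a x \<partial>lborel) \<le> lam * ((1 / r k ^ DIM('a) - 1) / (1 - r k)) * Z a"
      using r by (intro scaling_inequality nonneg)
    also have "\<dots> \<le> lam * (2 * 2 ^ DIM('a)) * Z a"
      unfolding r_def using lam Z_pos[of a]
      by (intro mult_right_mono mult_left_mono slope_factor_bound) auto
    finally show ?thesis .
  qed
  ultimately show ?thesis by (intro LIMSEQ_le_const2) auto
qed

section \<open>A priori bounds and the self-consistent potential\<close>

lemma radial_derivatives:
  "\<exists>E. \<forall>i<N. real_polynomial_function (E i) \<and> (\<forall>x. ((\<lambda>r. \<phi> i (r *\<^sub>R x)) has_real_derivative E i x) (at 1))"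
proof -
  have "\<forall>i\<in>{..<N}. \<exists>F. real_polynomial_function F \<and> (\<forall>x. ((\<lambda>r. \<phi> i (r *\<^sub>R x)) has_real_derivative F x) (at 1))"
    using real_polynomial_function_radial_derivative[OF phi] by blast
  from bchoice[OF this] show ?thesis by (simp only: Ball_def lessThan_iff)
qed

text \<open>The two sums are the derivatives at \<open>r = 1\<close> of \<open>\<psi>(r x - y)\<close> and \<open>\<psi>(r y - x)\<close>, that is \<open>x \<bullet> \<nabla>\<psi>(x - y)\<close> and
  \<open>- y \<bullet> \<nabla>\<psi>(x - y)\<close>, the latter because \<open>\<psi>\<close> is even.  They add up to \<open>z \<bullet> \<nabla>\<psi>(z)\<close> at \<open>z = x - y\<close>.\<close>

lemma symmetrised_radial_derivative_ge:
  assumes E: "\<And>i x. i < N \<Longrightarrow> ((\<lambda>r. \<phi> i (r *\<^sub>R x)) has_real_derivative E i x) (at 1)"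
  shows "(\<Sum>i<N. \<eta> i y * E i x) + (\<Sum>i<N. \<eta> i x * E i y) \<ge> \<psi> (x - y)"
proof -
  obtain D where D: "(\<psi> has_derivative D) (at (x - y))" and ge: "D (x - y) \<ge> \<psi> (x - y)"
    using psi_radial by blast
  have lin: "linear D" using D by (simp add: has_derivative_linear)
  have D_mult: "(\<lambda>h. D (h *\<^sub>R v)) = (*) (D v)" "(\<lambda>h. D (- (h *\<^sub>R v))) = (*) (- D v)" for v
    by (auto simp: fun_eq_iff linear_neg[OF lin] linear_scale[OF lin])
  have d: "((\<lambda>r. \<psi> (r *\<^sub>R x - y)) has_real_derivative (\<Sum>i<N. \<eta> i y * E i x)) (at 1)" for x y
    unfolding psi_eq
  proof (rule DERIV_sum)
    fix i assume "i \<in> {..<N}"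
    then have "i < N" by simp
    from DERIV_cmult_right[OF E[OF this, of x], of "\<eta> i y"]
    show "((\<lambda>r. \<phi> i (r *\<^sub>R x) * \<eta> i y) has_real_derivative \<eta> i y * E i x) (at 1)"
      by (simp add: mult.commute)
  qed
  have "((\<lambda>r. \<psi> (r *\<^sub>R x - y)) has_derivative (\<lambda>h. D (h *\<^sub>R x))) (at 1)"
    using D by (intro has_derivative_compose[of "\<lambda>r. r *\<^sub>R x - y" "\<lambda>h. h *\<^sub>R x" 1 UNIV \<psi> D])
      (auto intro!: derivative_eq_intros)
  then have "((\<lambda>r. \<psi> (r *\<^sub>R x - y)) has_real_derivative D x) (at 1)"
    using D_mult[of x] by (simp add: has_field_derivative_def)
  then have 1: "(\<Sum>i<N. \<eta> i y * E i x) = D x" using d by (rule DERIV_unique[symmetric])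
  have "((\<lambda>r. \<psi> (x - r *\<^sub>R y)) has_derivative (\<lambda>h. D (- (h *\<^sub>R y)))) (at 1)"
    using D by (intro has_derivative_compose[of "\<lambda>r. x - r *\<^sub>R y" "\<lambda>h. - (h *\<^sub>R y)" 1 UNIV \<psi> D])
      (auto intro!: derivative_eq_intros)
  moreover have "\<psi> (x - r *\<^sub>R y) = \<psi> (r *\<^sub>R y - x)" for r using psi_even[of "x - r *\<^sub>R y"] by simp
  ultimately have "((\<lambda>r. \<psi> (r *\<^sub>R y - x)) has_real_derivative - D y) (at 1)"
    using D_mult[of y] by (simp add: has_field_derivative_def)
  then have 2: "(\<Sum>i<N. \<eta> i x * E i y) = - D y" using d by (rule DERIV_unique[symmetric])
  from ge show ?thesis unfolding 1 2 using lin by (simp add: linear_diff)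
qed

text \<open>The double integral of \<open>symmetrised_radial_derivative_ge\<close> against \<open>w(x) w(y)\<close>.  Every term is a sum of
  products, so the integrals in \<open>y\<close> and in \<open>x\<close> are taken one after the other.\<close>

lemma symmetrised_double_integral:
  fixes a :: "nat \<Rightarrow> real" and E :: "nat \<Rightarrow> 'a \<Rightarrow> real"
  assumes E: "\<And>i. i < N \<Longrightarrow> real_polynomial_function (E i)"
    "\<And>i x. i < N \<Longrightarrow> ((\<lambda>r. \<phi> i (r *\<^sub>R x)) has_real_derivative E i x) (at 1)"
  defines "m \<equiv> (\<lambda>i. (\<integral>x. \<eta> i x * w a x \<partial>lborel))" and "e \<equiv> (\<lambda>i. (\<integral>x. E i x * w a x \<partial>lborel))"
    and "f \<equiv> (\<lambda>i. (\<integral>x. \<phi> i x * w a x \<partial>lborel))"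
  shows "(\<Sum>i<N. f i * m i) \<le> 2 * (\<Sum>i<N. m i * e i)"
proof -
  have poly_sum: "real_polynomial_function (\<lambda>x. \<Sum>i<N. c i * g i x)"
    if "\<And>i. i < N \<Longrightarrow> real_polynomial_function (g i)" for c :: "nat \<Rightarrow> real" and g :: "nat \<Rightarrow> 'a \<Rightarrow> real"
    using that by (intro real_polynomial_function_sum) auto
  have 1: "(\<Sum>i<N. \<phi> i x * m i) \<le> (\<Sum>i<N. E i x * m i) + (\<Sum>i<N. \<eta> i x * e i)" for x
  proof -
    have "(\<Sum>i<N. \<phi> i x * m i) = (\<integral>y. (\<Sum>i<N. \<phi> i x * \<eta> i y) * w a y \<partial>lborel)"
      unfolding m_def by (rule integral_lincomb_w[symmetric]) (rule eta)
    also have "\<dots> \<le> (\<integral>y. (\<Sum>i<N. E i x * \<eta> i y) * w a y + (\<Sum>i<N. \<eta> i x * E i y) * w a y \<partial>lborel)"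
    proof (rule integral_mono)
      show "integrable lborel (\<lambda>y. (\<Sum>i<N. \<phi> i x * \<eta> i y) * w a y)"
        by (intro integrable_poly_w poly_sum eta)
      show "integrable lborel (\<lambda>y. (\<Sum>i<N. E i x * \<eta> i y) * w a y + (\<Sum>i<N. \<eta> i x * E i y) * w a y)"
        by (intro Bochner_Integration.integrable_add integrable_poly_w poly_sum eta E(1))
      show "(\<Sum>i<N. \<phi> i x * \<eta> i y) * w a y \<le> (\<Sum>i<N. E i x * \<eta> i y) * w a y + (\<Sum>i<N. \<eta> i x * E i y) * w a y" for y
        using symmetrised_radial_derivative_ge[OF E(2), where x = x and y = y] w_pos[of a y]
        by (simp add: psi_eq mult.commute[of "E _ x"] distrib_right[symmetric] mult_right_mono)
    qed
    also have "\<dots> = (\<integral>y. (\<Sum>i<N. E i x * \<eta> i y) * w a y \<partial>lborel)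
        + (\<integral>y. (\<Sum>i<N. \<eta> i x * E i y) * w a y \<partial>lborel)"
      by (intro Bochner_Integration.integral_add integrable_poly_w poly_sum eta E(1))
    also have "\<dots> = (\<Sum>i<N. E i x * m i) + (\<Sum>i<N. \<eta> i x * e i)"
      unfolding m_def e_def by (simp only: integral_lincomb_w[OF eta] integral_lincomb_w[OF E(1)])
    finally show ?thesis .
  qed
  have "(\<Sum>i<N. f i * m i) = (\<integral>x. (\<Sum>i<N. m i * \<phi> i x) * w a x \<partial>lborel)"
    unfolding f_def by (subst integral_lincomb_w) (auto simp: phi mult.commute)
  also have "\<dots> \<le> (\<integral>x. (\<Sum>i<N. m i * E i x) * w a x + (\<Sum>i<N. e i * \<eta> i x) * w a x \<partial>lborel)"
  proof (rule integral_mono)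
    show "integrable lborel (\<lambda>y. (\<Sum>i<N. m i * \<phi> i y) * w a y)"
      by (intro integrable_poly_w poly_sum phi)
    show "integrable lborel (\<lambda>y. (\<Sum>i<N. m i * E i y) * w a y + (\<Sum>i<N. e i * \<eta> i y) * w a y)"
      by (intro Bochner_Integration.integrable_add integrable_poly_w poly_sum eta E(1))
    show "(\<Sum>i<N. m i * \<phi> i x) * w a x \<le> (\<Sum>i<N. m i * E i x) * w a x + (\<Sum>i<N. e i * \<eta> i x) * w a x" for x
      using 1[of x] w_pos[of a x]
      by (simp add: mult.commute[of "m _"] mult.commute[of "e _"] distrib_right[symmetric] mult_right_mono)
  qed
  also have "\<dots> = (\<Sum>i<N. m i * e i) + (\<Sum>i<N. e i * m i)"
  proof -
    have "(\<integral>x. (\<Sum>i<N. m i * E i x) * w a x + (\<Sum>i<N. e i * \<eta> i x) * w a x \<partial>lborel)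
        = (\<integral>x. (\<Sum>i<N. m i * E i x) * w a x \<partial>lborel) + (\<integral>x. (\<Sum>i<N. e i * \<eta> i x) * w a x \<partial>lborel)"
      by (intro Bochner_Integration.integral_add integrable_poly_w poly_sum eta E(1))
    then show ?thesis
      by (simp only: integral_lincomb_w[OF eta] integral_lincomb_w[OF E(1)] m_def e_def)
  qed
  finally show ?thesis by (simp add: mult.commute)
qed

definition energy_bound :: real where "energy_bound = c0 + lam * (2 * 2 ^ DIM('a))"

text \<open>In the virial inequality the contribution of \<open>P a = s (\<psi> \<ast> u)\<close> is a double integral of \<open>x \<bullet> \<nabla>\<psi>(x - y)\<close>, which
  by symmetrisation is at least half the integral of \<open>P a\<close>.  The bound depends neither on \<open>a\<close> nor
  on \<open>s\<close>.\<close>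

lemma energy_estimate:
  assumes s: "0 \<le> s" and nonneg: "\<And>x. P a x \<ge> 0" and a: "\<And>i. i < N \<Longrightarrow> a i = s * M a i"
  shows "(\<integral>x. ((norm x)\<^sup>2 + P a x / 2) * w a x \<partial>lborel) \<le> energy_bound * Z a"
proof -
  obtain E where E': "\<forall>i<N. real_polynomial_function (E i)
      \<and> (\<forall>x. ((\<lambda>r. \<phi> i (r *\<^sub>R x)) has_real_derivative E i x) (at 1))"
    using radial_derivatives by blast
  have E: "\<And>i. i < N \<Longrightarrow> real_polynomial_function (E i)"
    "\<And>i x. i < N \<Longrightarrow> ((\<lambda>r. \<phi> i (r *\<^sub>R x)) has_real_derivative E i x) (at 1)"
    using E' by blast+
  define F where "F x = (\<Sum>i<N. a i * E i x)" for x
  have F: "real_polynomial_function F"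
    unfolding F_def using E(1) by (intro real_polynomial_function_sum) auto
  have "((\<lambda>r. P a (r *\<^sub>R x)) has_real_derivative F x) (at 1)" for x
    unfolding P_def F_def using E(2) by (intro DERIV_sum DERIV_cmult) auto
  from virial_inequality[OF nonneg F this]
  have virial: "(\<integral>x. ((norm x)\<^sup>2 - c0 + F x) * w a x \<partial>lborel) \<le> lam * (2 * 2 ^ DIM('a)) * Z a" .
  define m where "m i = (\<integral>x. \<eta> i x * w a x \<partial>lborel)" for i
  have a': "a i = s / Z a * m i" if "i < N" for i using a[OF that] by (simp add: M_def m_def)
  have "(\<integral>x. P a x * w a x \<partial>lborel) = s / Z a * (\<Sum>i<N. (\<integral>x. \<phi> i x * w a x \<partial>lborel) * m i)"
    unfolding P_def by (subst integral_lincomb_w) (auto simp: phi a' sum_distrib_left mult_ac)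
  also have "\<dots> \<le> s / Z a * (2 * (\<Sum>i<N. m i * (\<integral>x. E i x * w a x \<partial>lborel)))"
    unfolding m_def using s Z_pos[of a] by (intro mult_left_mono symmetrised_double_integral[OF E]) auto
  also have "\<dots> = 2 * (\<integral>x. F x * w a x \<partial>lborel)"
    unfolding F_def by (subst integral_lincomb_w) (auto simp: E(1) a' sum_distrib_left mult_ac)
  finally have PF: "(\<integral>x. P a x * w a x \<partial>lborel) \<le> 2 * (\<integral>x. F x * w a x \<partial>lborel)" .
  have in2: "integrable lborel (\<lambda>x. (norm x)\<^sup>2 * w a x)" by (intro integrable_poly_w poly_norm_sq)
  have iF: "integrable lborel (\<lambda>x. F x * w a x)" by (intro integrable_poly_w F)
  have iP: "integrable lborel (\<lambda>x. P a x * w a x)" by (intro integrable_poly_w P_poly)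
  have "(\<integral>x. ((norm x)\<^sup>2 - c0 + F x) * w a x \<partial>lborel)
      = (\<integral>x. (norm x)\<^sup>2 * w a x \<partial>lborel) - c0 * Z a + (\<integral>x. F x * w a x \<partial>lborel)"
    using in2 iF integrable_w[of a] by (simp add: distrib_right left_diff_distrib Z_def)
  moreover have "(\<integral>x. ((norm x)\<^sup>2 + P a x / 2) * w a x \<partial>lborel)
      = (\<integral>x. (norm x)\<^sup>2 * w a x \<partial>lborel) + (\<integral>x. P a x * w a x \<partial>lborel) / 2"
    using in2 iP by (simp add: distrib_right)
  ultimately show ?thesis using virial PF by (simp add: energy_bound_def algebra_simps)
qed

text \<open>Somewhere a function is not much larger than its mean.\<close>

lemma low_energy_point:
  assumes "0 \<le> s" "\<And>x. P a x \<ge> 0" "\<And>i. i < N \<Longrightarrow> a i = s * M a i"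
  shows "\<exists>m. (norm m)\<^sup>2 + P a m / 2 \<le> energy_bound + 1"
proof (rule ccontr)
  assume "\<not> ?thesis"
  then have ge: "(norm m)\<^sup>2 + P a m / 2 \<ge> energy_bound + 1" for m
    by (auto simp: not_le less_imp_le)
  have "(energy_bound + 1) * Z a = (\<integral>x. (energy_bound + 1) * w a x \<partial>lborel)"
    by (simp add: Z_def)
  also have "\<dots> \<le> (\<integral>x. ((norm x)\<^sup>2 + P a x / 2) * w a x \<partial>lborel)"
    using ge w_pos[of a] P_poly poly_norm_sq
    by (intro integral_mono integrable_mult_right integrable_w integrable_poly_w real_polynomial_function.intros(3)
        real_polynomial_function_divide mult_right_mono) (auto simp: less_imp_le)
  also have "\<dots> \<le> energy_bound * Z a" by (rule energy_estimate[OF assms])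
  finally show False using Z_pos[of a] by (simp add: algebra_simps)
qed

lemma self_consistent_imp_P_eq:
  assumes a: "\<And>i. i < N \<Longrightarrow> a i = s * M a i"
  shows "P a x = s * ((\<integral>y. \<psi> (x - y) * w a y \<partial>lborel) / Z a)"
  unfolding P_moments[symmetric] unfolding P_def by (simp add: a sum_distrib_left mult.assoc)

lemma self_consistent_imp_nonneg:
  assumes "0 \<le> s" "\<And>i. i < N \<Longrightarrow> a i = s * M a i"
  shows "P a x \<ge> 0"
proof -
  have "P a x = s * ((\<integral>y. \<psi> (x - y) * w a y \<partial>lborel) / Z a)"
    by (rule self_consistent_imp_P_eq[OF assms(2)])
  also have "\<dots> \<ge> 0"
    using assms(1) psi_nonneg w_pos[of a] Z_pos[of a]
    by (intro mult_nonneg_nonneg divide_nonneg_pos integral_nonneg_AE AE_I2) (auto simp: less_imp_le)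
  finally show ?thesis .
qed

text \<open>Around a point \<open>m\<close> of low energy the potential \<open>P a = s (\<psi> \<ast> u)\<close> stays bounded, because \<open>\<psi>(z + h)\<close> is
  controlled by \<open>\<psi>(z)\<close> for \<open>|h| \<le> 1\<close>, and \<open>m\<close> itself lies in a fixed ball on which \<open>V\<close> is bounded.\<close>

lemma Z_lower_bound:
  "\<exists>z0>0. \<forall>s a. 0 \<le> s \<longrightarrow> s \<le> 1 \<longrightarrow> (\<forall>i<N. a i = s * M a i) \<longrightarrow> Z a \<ge> z0"
proof -
  let ?e = "energy_bound + 1"
  have "compact (V ` cball 0 (?e + 2))"
    by (intro compact_continuous_image continuous_on_subset[OF V_cont] compact_cball) auto
  then have "bdd_above (V ` cball 0 (?e + 2))" by (intro bounded_imp_bdd_above compact_imp_bounded)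
  then obtain v where v: "\<And>x. x \<in> cball 0 (?e + 2) \<Longrightarrow> V x \<le> v"
    unfolding bdd_above_def by blast
  define z0 where "z0 = exp (- (v + K * (1 + 2 * ?e)) / lam) * measure lborel (cball 0 1 :: 'a set)"
  show ?thesis
  proof (intro exI[of _ z0] conjI allI impI)
    show "z0 > 0" using measure_unit_cball_pos by (simp add: z0_def)
    fix s a assume s: "0 \<le> s" "s \<le> 1" and "\<forall>i<N. a i = s * M a i"
    then have a: "\<And>i. i < N \<Longrightarrow> a i = s * M a i" by blast
    have nonneg: "P a x \<ge> 0" for x by (rule self_consistent_imp_nonneg[OF s(1) a])
    obtain m where m: "(norm m)\<^sup>2 + P a m / 2 \<le> ?e"
      using low_energy_point[OF s(1) nonneg a] by blast
    have Pm: "P a m \<le> 2 * ?e" 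
    proof -
      have "p \<le> 2 * e" if "q + p / 2 \<le> e" "0 \<le> q" for p q e :: real using that by linarith
      from this[OF m zero_le_power2] show ?thesis .
    qed
    have "(norm m)\<^sup>2 \<le> ?e" using m nonneg[of m] by linarith
    moreover have "norm m \<le> (norm m)\<^sup>2 + 1"
    proof -
      have "0 \<le> (norm m - 1)\<^sup>2 + (norm m)\<^sup>2 + 1" by simp
      then show ?thesis by (simp add: power2_eq_square algebra_simps)
    qed
    ultimately have nm: "norm m \<le> ?e + 1" by simp
    have "exp (- (v + K * (1 + 2 * ?e)) / lam) \<le> w a x" if x: "x \<in> cball m 1" for x
    proof -
      have h: "norm (x - m) \<le> 1" using x by (simp add: dist_norm norm_minus_commute)
      have "norm x \<le> norm m + norm (x - m)" using norm_triangle_ineq[of m "x - m"] by simp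
      then have Vx: "V x \<le> v" using nm h by (intro v) simp
      have "P a x = s * ((\<integral>y. \<psi> (x - y) * w a y \<partial>lborel) / Z a)" by (rule self_consistent_imp_P_eq[OF a])
      also have "\<dots> \<le> s * ((\<integral>y. K * w a y + K * (\<psi> (m - y) * w a y) \<partial>lborel) / Z a)"
      proof (intro mult_left_mono divide_right_mono integral_mono)
        fix y
        have "\<psi> (x - y) \<le> K * (1 + \<psi> (m - y))" using psi_shift[OF h, of "m - y"] by simp
        then have "\<psi> (x - y) * w a y \<le> (K * (1 + \<psi> (m - y))) * w a y"
          using w_pos[of a y] by (intro mult_right_mono) auto
        then show "\<psi> (x - y) * w a y \<le> K * w a y + K * (\<psi> (m - y) * w a y)" by (simp add: algebra_simps)
      qed (use s Z_pos[of a] in \<open>auto intro!: integrable_psi_w integrable_w integrable_mult_right\<close>)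
      also have "\<dots> = s * ((K * Z a + K * (\<integral>y. \<psi> (m - y) * w a y \<partial>lborel)) / Z a)"
        using integrable_psi_w[of m a] integrable_w[of a] by (simp add: Z_def)
      also have "\<dots> = s * K + K * P a m"
        using self_consistent_imp_P_eq[OF a, of m] Z_pos[of a] by (simp add: field_simps)
      also have "\<dots> \<le> K + K * (2 * ?e)"
        using s K Pm by (intro add_mono mult_left_mono mult_left_le_one_le) auto
      finally have "P a x \<le> K * (1 + 2 * ?e)" by (simp add: algebra_simps)
      then show ?thesis
        using Vx nonneg[of x] lam unfolding w_def exp_le_cancel_iff by (intro divide_right_mono) auto
    qed
    then show "Z a \<ge> z0"
      unfolding z0_def Z_def by (intro integral_ge_on_cball[OF integrable_w]) (auto simp: w_pos less_imp_le)
  qed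
qed

text \<open>The numerator of a moment is at most its value for the weight \<open>exp (-V / lam)\<close>, the denominator at least
  the lower bound for \<open>Z\<close>.\<close>

lemma moments_bounded:
  "\<exists>R>0. \<forall>s a. 0 \<le> s \<longrightarrow> s \<le> 1 \<longrightarrow> (\<forall>i<N. a i = s * M a i) \<longrightarrow> (\<forall>i<N. \<bar>a i\<bar> < R)"
proof -
  obtain z0 where z0: "z0 > 0"
    and Z: "\<forall>s a. 0 \<le> s \<longrightarrow> s \<le> 1 \<longrightarrow> (\<forall>i<N. a i = s * M a i) \<longrightarrow> Z a \<ge> z0"
    using Z_lower_bound by blast
  define b where "b i = (\<integral>x. \<bar>\<eta> i x * exp (- V x / lam)\<bar> \<partial>lborel)" for i
  have b: "b i \<ge> 0" for i unfolding b_def by simp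
  show ?thesis
  proof (intro exI[of _ "1 + (\<Sum>i<N. b i) / z0"] conjI allI impI)
    show "0 < 1 + (\<Sum>i<N. b i) / z0" using b z0 by (simp add: sum_nonneg add_pos_nonneg)
    fix s a i assume s: "0 \<le> s" "s \<le> 1" and a: "\<forall>i<N. a i = s * M a i" and i: "i < N"
    have "\<bar>\<integral>x. \<eta> i x * w a x \<partial>lborel\<bar> \<le> (\<integral>x. \<bar>\<eta> i x * w a x\<bar> \<partial>lborel)"
      using integral_norm_bound[of lborel "\<lambda>x. \<eta> i x * w a x"] by simp
    also have "\<dots> \<le> b i"
      unfolding b_def
    proof (intro integral_mono integrable_abs integrable_poly_w integrable_poly_exp_V eta i)
      show "\<bar>\<eta> i x * w a x\<bar> \<le> \<bar>\<eta> i x * exp (- V x / lam)\<bar>" for x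
        using w_le[of a x] w_pos[of a x] by (auto simp: abs_mult less_imp_le intro!: mult_left_mono)
    qed
    also have "\<dots> \<le> (\<Sum>i<N. b i)" using i b by (intro member_le_sum) auto
    finally have num: "\<bar>\<integral>x. \<eta> i x * w a x \<partial>lborel\<bar> \<le> (\<Sum>i<N. b i)" .
    have "\<bar>a i\<bar> \<le> \<bar>M a i\<bar>" using s a[rule_format, OF i] by (simp add: abs_mult mult_left_le_one_le)
    also have "\<dots> \<le> (\<Sum>i<N. b i) / z0"
      unfolding M_def abs_divide using num Z[rule_format, OF s, of a] a z0 b by (intro frac_le) (auto simp: sum_nonneg)
    finally show "\<bar>a i\<bar> < 1 + (\<Sum>i<N. b i) / z0" by simp
  qed
qed

text \<open>A fixed point of the moment map is a potential \<open>W = \<psi> \<ast> u\<close> with \<open>u\<close> the Gibbs density of \<open>V + W\<close>.\<close>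

theorem self_consistent_potential:
  "\<exists>W. real_polynomial_function W \<and>
    (\<forall>f. real_polynomial_function f \<longrightarrow> integrable lborel (\<lambda>x. f x * exp (- (V x + W x) / lam))) \<and>
    (\<forall>x. W x \<ge> 0) \<and>
    (\<integral>y. exp (- (V y + W y) / lam) \<partial>lborel) > 0 \<and>
    (\<forall>x. W x = (\<integral>y. \<psi> (x - y) * exp (- (V y + W y) / lam) \<partial>lborel) / (\<integral>y. exp (- (V y + W y) / lam) \<partial>lborel))"
proof -
  obtain R where R: "R > 0"
    and bound: "\<forall>s a. 0 \<le> s \<longrightarrow> s \<le> 1 \<longrightarrow> (\<forall>i<N. a i = s * M a i) \<longrightarrow> (\<forall>i<N. \<bar>a i\<bar> < R)"
    using moments_bounded by blast
  have "\<exists>a. \<forall>i<N. M a i = a i"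
  proof (rule leray_schauder_coordinates[OF R])
    show "(\<lambda>k. M (a k) i) \<longlonglongrightarrow> M l i" if "\<And>j. j < N \<Longrightarrow> (\<lambda>k. a k j) \<longlonglongrightarrow> l j" "i < N" for a l i
      using that by (rule M_cont)
    show "\<bar>a i\<bar> < R" if "0 \<le> s" "s \<le> 1" "\<And>j. j < N \<Longrightarrow> a j = s * M a j" "i < N" for a s i
      using bound that by blast
  qed
  then obtain a where a: "\<forall>i<N. M a i = a i" by blast
  have a1: "a i = 1 * M a i" if "i < N" for i using a that by simp
  have nonneg: "P a x \<ge> 0" for x by (rule self_consistent_imp_nonneg[of 1 a, OF _ a1]) auto
  have w: "w a x = exp (- (V x + P a x) / lam)" for x
    using nonneg by (simp add: w_def max_def)
  show ?thesis
  proof (intro exI[of _ "P a"] conjI allI impI)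
    show "P a x = (\<integral>y. \<psi> (x - y) * exp (- (V y + P a y) / lam) \<partial>lborel) / (\<integral>y. exp (- (V y + P a y) / lam) \<partial>lborel)" for x
      using self_consistent_imp_P_eq[OF a1, of x] by (simp add: w Z_def)
    show "(\<integral>y. exp (- (V y + P a y) / lam) \<partial>lborel) > 0"
      using Z_pos[of a] by (simp add: w Z_def)
    show "integrable lborel (\<lambda>x. f x * exp (- (V x + P a x) / lam))" if "real_polynomial_function f" for f
      using integrable_poly_w[OF that, of a] by (simp only: w)
  qed (use nonneg P_poly in auto)
qed

section \<open>The stationary density\<close>

lemma grad_phi: "i < N \<Longrightarrow> (\<phi> i has_derivative (\<lambda>v. grad (\<phi> i) x \<bullet> v)) (at x)"
  by (intro has_derivative_grad differentiable_at_real_polynomial_function phi)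

text \<open>Differentiate \<open>\<psi>(x - y) = (\<Sum>i<N. \<phi>\<^sub>i(x) \<eta>\<^sub>i(y))\<close> in \<open>x\<close> with \<open>y\<close> fixed.\<close>

lemma grad_psi: "grad \<psi> (x - y) = (\<Sum>i<N. \<eta> i y *\<^sub>R grad (\<phi> i) x)"
proof (rule grad_eqI)
  have "((\<lambda>z. \<psi> ((z + y) - y)) has_derivative (\<lambda>v. \<Sum>i<N. (grad (\<phi> i) x \<bullet> v) * \<eta> i y)) (at (x - y))"
    unfolding psi_eq
  proof (intro has_derivative_sum has_derivative_mult_left)
    fix i assume "i \<in> {..<N}"
    then have "(\<phi> i has_derivative (\<lambda>v. grad (\<phi> i) x \<bullet> v)) (at ((x - y) + y))" using grad_phi[of i x] by simp
    then show "((\<lambda>z. \<phi> i (z + y)) has_derivative (\<lambda>v. grad (\<phi> i) x \<bullet> v)) (at (x - y))"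
      by (intro has_derivative_compose[of "\<lambda>z. z + y" "\<lambda>v. v" _ _ "\<phi> i", simplified]) (auto intro!: derivative_eq_intros)
  qed
  moreover have "(\<lambda>v. \<Sum>i<N. (grad (\<phi> i) x \<bullet> v) * \<eta> i y) = (\<bullet>) (\<Sum>i<N. \<eta> i y *\<^sub>R grad (\<phi> i) x)"
    by (auto simp: fun_eq_iff inner_sum_left mult.commute)
  ultimately show "(\<psi> has_derivative (\<bullet>) (\<Sum>i<N. \<eta> i y *\<^sub>R grad (\<phi> i) x)) (at (x - y))"
    by simp
qed

lemma poly_psi: "real_polynomial_function (\<lambda>y. \<psi> (x - y))"
  unfolding psi_eq by (intro real_polynomial_function_sum real_polynomial_function.intros(2,4) eta) auto

lemma V_bounded_below: "V x \<ge> - (C2\<^sup>2 / (4 * C4))"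
proof -
  have "C2 * (norm x)\<^sup>2 - C4 * norm x ^ 4 \<le> C2\<^sup>2 / (4 * C4)"
    using quadratic_le[OF C4, of C2 "(norm x)\<^sup>2"] by (simp flip: power_mult)
  with V_lower[of x] show ?thesis by linarith
qed

text \<open>The density is the Gibbs density \<open>u\<close> of the self-consistent potential times a Gaussian in the momentum.
  With \<open>h = grad V + conv (grad \<psi>) \<rho>\<close> its logarithmic gradients are \<open>- h / lam\<close> and \<open>- p / lam\<close>; in the equation
  the terms with \<open>p \<bullet> h\<close> cancel, and so do those with the dimension and with \<open>p \<bullet> p\<close>.\<close>

theorem stationary_measure_exists:
  assumes V2: "Ck 2 V"
  shows "\<exists>\<rho>. stationary_measure V \<psi> lam \<rho>"
proof -
  obtain W where W: "real_polynomial_function W"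
    and int: "\<forall>f. real_polynomial_function f \<longrightarrow> integrable lborel (\<lambda>x. f x * exp (- (V x + W x) / lam))"
    and W_nonneg: "\<forall>x. W x \<ge> 0"
    and Zpos: "(\<integral>y. exp (- (V y + W y) / lam) \<partial>lborel) > 0"
    and W_eq: "\<forall>x. W x = (\<integral>y. \<psi> (x - y) * exp (- (V y + W y) / lam) \<partial>lborel)
        / (\<integral>y. exp (- (V y + W y) / lam) \<partial>lborel)"
    using self_consistent_potential by blast
  define u where "u q = exp (- (V q + W q) / lam)" for q
  define g where "g p = exp (- ((norm p)\<^sup>2 / 2) / lam)" for p :: 'a
  define Z1 where "Z1 = (\<integral>y. u y \<partial>lborel)"
  define Z2 where "Z2 = (\<integral>p. g p \<partial>lborel)"
  have Z1: "Z1 > 0" using Zpos by (simp add: Z1_def u_def[abs_def])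
  have g_int: "integrable lborel g" unfolding g_def using lam by (rule integrable_gaussian)
  have Z2: "Z2 > 0"
  proof -
    have "exp (- (1 / 2) / lam) \<le> g p" if "p \<in> cball 0 1" for p
    proof -
      have "(norm p)\<^sup>2 \<le> 1" using that by (simp add: power_le_one)
      then show ?thesis unfolding g_def exp_le_cancel_iff using lam by (intro divide_right_mono) auto
    qed
    then have "exp (- (1 / 2) / lam) * measure lborel (cball 0 1 :: 'a set) \<le> Z2"
      unfolding Z2_def by (intro integral_ge_on_cball[OF g_int, where m = 0]) (auto simp: g_def)
    with measure_unit_cball_pos[where 'a = 'a] show ?thesis
      by (meson exp_gt_zero mult_pos_pos less_le_trans)
  qed
  have u_int: "integrable lborel (\<lambda>x. f x * u x)" if "real_polynomial_function f" for f
    using int that by (simp add: u_def)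
  define \<rho> where "\<rho> z = (u (fst z) / Z1) * (g (snd z) / Z2)" for z
  have \<rho>_pos: "\<rho> z > 0" for z using Z1 Z2 by (simp add: \<rho>_def u_def g_def)
  \<comment> \<open>The momentum factor has total mass one, so integrals against \<open>\<rho>\<close> of functions of the position
    alone are integrals against \<open>u / Z1\<close>.\<close>
  have marg: "has_bochner_integral lborel (\<lambda>z. \<rho> z *\<^sub>R f (fst z)) (\<integral>x. (u x / Z1) *\<^sub>R f x \<partial>lborel)"
    if "integrable lborel (\<lambda>x. u x *\<^sub>R f x)" for f :: "'a \<Rightarrow> 'b::euclidean_space"
  proof -
    have "integrable lborel (\<lambda>x. (1 / Z1) *\<^sub>R (u x *\<^sub>R f x))" using that by (rule integrable_scaleR_right)
    then have 1: "integrable lborel (\<lambda>x. (u x / Z1) *\<^sub>R f x)" by simp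
    have "integrable lborel (\<lambda>p. g p / Z2)" using g_int by simp
    from has_bochner_integral_lborel_tensor[OF 1 this] show ?thesis
      using Z2 by (simp add: \<rho>_def Z2_def[symmetric] mult.commute)
  qed
  have \<rho>_eta: "(\<lambda>(q', p'). \<rho> (q', p') *\<^sub>R f (q - q')) = (\<lambda>z. \<rho> z *\<^sub>R f (q - fst z))" for f :: "'a \<Rightarrow> 'b::euclidean_space" and q
    by auto
  have u_int1: "integrable lborel u" using u_int[OF real_polynomial_function.intros(2)[of 1]] by simp
  have prob: "probability_density \<rho>"
    unfolding probability_density_def
  proof (intro conjI allI)
    show "0 \<le> \<rho> z" for z using \<rho>_pos[of z] by simp
    show "has_bochner_integral lborel \<rho> 1"
      using marg[of "\<lambda>x. 1::real"] u_int1 Z1 by (simp add: Z1_def[symmetric])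
  qed
  have bdd: "essentially_bounded \<rho>"
    unfolding essentially_bounded_def
  proof (intro exI AE_I2)
    fix z :: "'a \<times> 'a"
    have "- (V (fst z) + W (fst z)) / lam \<le> (C2\<^sup>2 / (4 * C4)) / lam"
      using V_bounded_below[of "fst z"] W_nonneg[rule_format, of "fst z"] lam by (intro divide_right_mono) auto
    then have "u (fst z) \<le> exp ((C2\<^sup>2 / (4 * C4)) / lam)" unfolding u_def exp_le_cancel_iff .
    moreover have "g (snd z) \<le> 1" using lam by (simp add: g_def)
    ultimately have "\<rho> z \<le> (exp ((C2\<^sup>2 / (4 * C4)) / lam) / Z1) * (1 / Z2)"
      unfolding \<rho>_def using Z1 Z2 by (intro mult_mono divide_right_mono) (auto simp: g_def)
    then show "\<bar>\<rho> z\<bar> \<le> (exp ((C2\<^sup>2 / (4 * C4)) / lam) / Z1) * (1 / Z2)" using \<rho>_pos[of z] by simp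
  qed
  have psi_int: "integrable lborel (\<lambda>y. u y *\<^sub>R \<psi> (q - y))" for q
    using u_int[OF poly_psi, of q] by (simp add: mult.commute)
  have conv_psi: "conv_defined \<psi> \<rho>"
    unfolding conv_defined_def \<rho>_eta using marg[OF psi_int] by (auto simp: has_bochner_integral_iff)
  have eta_int: "integrable lborel (\<lambda>y. \<eta> i y * u y)" if "i < N" for i using u_int[OF eta[OF that]] .
  define c where "c i = (\<integral>y. \<eta> i y * u y \<partial>lborel) / Z1" for i
  have gpsi: "has_bochner_integral lborel (\<lambda>y. (u y / Z1) *\<^sub>R grad \<psi> (q - y)) (\<Sum>i<N. c i *\<^sub>R grad (\<phi> i) q)" for q
  proof -
    have "has_bochner_integral lborel (\<lambda>y. \<Sum>i<N. (\<eta> i y * u y / Z1) *\<^sub>R grad (\<phi> i) q) (\<Sum>i<N. c i *\<^sub>R grad (\<phi> i) q)"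
    proof (rule has_bochner_integral_sum)
      fix i assume "i \<in> {..<N}"
      then have "has_bochner_integral lborel (\<lambda>y. \<eta> i y * u y / Z1) (c i)"
        unfolding c_def using eta_int[of i] by (intro has_bochner_integral_divide_zero) (auto simp: has_bochner_integral_iff)
      then show "has_bochner_integral lborel (\<lambda>y. (\<eta> i y * u y / Z1) *\<^sub>R grad (\<phi> i) q) (c i *\<^sub>R grad (\<phi> i) q)"
        by (rule has_bochner_integral_scaleR_left)
    qed
    then show ?thesis by (simp add: grad_psi scaleR_sum_right mult.commute)
  qed
  have gpsi_int: "integrable lborel (\<lambda>y. u y *\<^sub>R grad \<psi> (q - y))" for q
  proof -
    have "integrable lborel (\<lambda>y. Z1 *\<^sub>R ((u y / Z1) *\<^sub>R grad \<psi> (q - y)))"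
      using gpsi[of q] by (intro integrable_scaleR_right) (auto simp: has_bochner_integral_iff)
    then show ?thesis using Z1 by simp
  qed
  have conv_grad: "conv_defined (grad \<psi>) \<rho>"
    unfolding conv_defined_def \<rho>_eta using marg[OF gpsi_int] by (auto simp: has_bochner_integral_iff)
  have conv_eq: "conv (grad \<psi>) \<rho> q = (\<Sum>i<N. c i *\<^sub>R grad (\<phi> i) q)" for q
    unfolding conv_def \<rho>_eta using marg[OF gpsi_int, of q] gpsi[of q] by (auto simp: has_bochner_integral_iff)
  have W_sum: "W q = (\<Sum>i<N. c i * \<phi> i q)" for q
  proof -
    have "W q = (\<integral>y. \<psi> (q - y) * u y \<partial>lborel) / Z1"
      unfolding u_def Z1_def by (rule W_eq[rule_format])
    also have "(\<integral>y. \<psi> (q - y) * u y \<partial>lborel) = (\<integral>y. (\<Sum>i<N. \<phi> i q * (\<eta> i y * u y)) \<partial>lborel)"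
      by (simp add: psi_eq sum_distrib_right mult.assoc)
    also have "\<dots> = (\<Sum>i<N. \<phi> i q * (\<integral>y. \<eta> i y * u y \<partial>lborel))"
      using eta_int by (subst Bochner_Integration.integral_sum) auto
    finally show ?thesis by (simp add: c_def sum_divide_distrib mult.commute)
  qed
  have W_deriv: "(W has_derivative (\<lambda>v. conv (grad \<psi>) \<rho> q \<bullet> v)) (at q)" for q
  proof -
    have "((\<lambda>q. \<Sum>i<N. c i * \<phi> i q) has_derivative (\<lambda>v. \<Sum>i<N. c i * (grad (\<phi> i) q \<bullet> v))) (at q)"
      by (intro has_derivative_sum has_derivative_mult_right grad_phi) auto
    moreover have "W = (\<lambda>q. \<Sum>i<N. c i * \<phi> i q)" by (rule ext) (rule W_sum)
    moreover have "(\<lambda>v. \<Sum>i<N. c i * (grad (\<phi> i) q \<bullet> v)) = (\<lambda>v. conv (grad \<psi>) \<rho> q \<bullet> v)"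
      by (simp add: conv_eq inner_sum_left)
    ultimately show ?thesis by simp
  qed
  have V_deriv: "(V has_derivative (\<lambda>v. grad V q \<bullet> v)) (at q)" for q
    using V2 by (intro has_derivative_grad) (auto simp: numeral_2_eq_2 differentiable_on_def)
  have C2: "Ck 2 \<rho>"
  proof -
    have rp: "real_polynomial_function (\<lambda>z::'a \<times> 'a. (norm (snd z))\<^sup>2)"
    proof -
      have "real_polynomial_function (\<lambda>z::'a \<times> 'a. \<Sum>b\<in>Basis. (snd z \<bullet> b)\<^sup>2)"
        by (intro real_polynomial_function_sum real_polynomial_function_power real_polynomial_function.intros(1)
            bounded_linear_inner_left_comp bounded_linear_snd finite_Basis)
      then show ?thesis by (simp only: norm_sq_eq_sum)
    qed
    have "Ck 2 (\<lambda>z::'a \<times> 'a. (1 / (Z1 * Z2)) * exp ((- 1 / lam) * ((V (fst z) + W (fst z)) + (1 / 2) * (norm (snd z))\<^sup>2)))"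
      by (intro Ck_mult Ck_exp Ck_add Ck_fst Ck_const V2 Ck_real_polynomial_function W rp)
    moreover have "(1 / (Z1 * Z2)) * exp ((- 1 / lam) * ((V (fst z) + W (fst z)) + (1 / 2) * (norm (snd z))\<^sup>2)) = \<rho> z" for z :: "'a \<times> 'a"
    proof -
      have "(- 1 / lam) * ((V (fst z) + W (fst z)) + (1 / 2) * (norm (snd z))\<^sup>2)
          = - (V (fst z) + W (fst z)) / lam + - ((norm (snd z))\<^sup>2 / 2) / lam"
        by (simp add: add_divide_distrib diff_divide_distrib distrib_left)
      then have "exp ((- 1 / lam) * ((V (fst z) + W (fst z)) + (1 / 2) * (norm (snd z))\<^sup>2)) = u (fst z) * g (snd z)"
        unfolding u_def g_def by (simp only: exp_add)
      then show ?thesis unfolding \<rho>_def by (simp only:) simp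
    qed
    ultimately show ?thesis by simp
  qed
  have pde: "- divergence (\<lambda>q. \<rho> (q, p) *\<^sub>R p) q
      + divergence (\<lambda>p. \<rho> (q, p) *\<^sub>R (grad V q + conv (grad \<psi>) \<rho> q + p)) p
      + lam * laplacian (\<lambda>p. \<rho> (q, p)) p = 0" for q p
  proof -
    define h where "h = grad V q + conv (grad \<psi>) \<rho> q"
    let ?r = "\<rho> (q, p)"
    \<comment> \<open>Both logarithmic gradients of the density.\<close>
    have dq: "((\<lambda>q. \<rho> (q, p)) has_derivative (\<lambda>v. - (?r / lam) * (h \<bullet> v))) (at q)"
    proof -
      have "(u has_derivative (\<lambda>v. u q * (- (grad V q \<bullet> v + conv (grad \<psi>) \<rho> q \<bullet> v) / lam))) (at q)"
        unfolding u_def[abs_def] using V_deriv[of q] W_deriv[of q]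
        by (auto intro!: derivative_eq_intros simp: divide_inverse)
      then have "((\<lambda>q. (u q / Z1) * (g p / Z2)) has_derivative
          (\<lambda>v. (u q * (- (grad V q \<bullet> v + conv (grad \<psi>) \<rho> q \<bullet> v) / lam) / Z1) * (g p / Z2))) (at q)"
        by (intro has_derivative_mult_left has_derivative_divide' bounded_linear.has_derivative[OF bounded_linear_divide])
      moreover have "(\<lambda>v. (u q * (- (grad V q \<bullet> v + conv (grad \<psi>) \<rho> q \<bullet> v) / lam) / Z1) * (g p / Z2))
          = (\<lambda>v. - (?r / lam) * (h \<bullet> v))"
        using Z1 Z2 lam by (auto simp: fun_eq_iff h_def \<rho>_def inner_add_left field_simps)
      ultimately show ?thesis by (simp add: \<rho>_def)
    qed
    have dp: "((\<lambda>p. \<rho> (q, p)) has_derivative (\<lambda>v. - (\<rho> (q, p) / lam) * (p \<bullet> v))) (at p)" for p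
    proof -
      have "((\<lambda>p. p \<bullet> p) has_derivative (\<lambda>v. p \<bullet> v + v \<bullet> p)) (at p)"
        by (rule has_derivative_inner[OF has_derivative_ident has_derivative_ident])
      from has_derivative_exp[OF has_derivative_mult_left[OF this, of "- 1 / (2 * lam)"]]
      have "((\<lambda>p. exp ((p \<bullet> p) * (- 1 / (2 * lam)))) has_derivative
          (\<lambda>v. exp ((p \<bullet> p) * (- 1 / (2 * lam))) * ((p \<bullet> v + v \<bullet> p) * (- 1 / (2 * lam))))) (at p)"
        by (simp only: mult.commute[of "exp _"])
      moreover have "(p \<bullet> v + v \<bullet> p) * (- 1 / (2 * lam)) = - (p \<bullet> v) / lam" for v
        using lam by (simp add: inner_commute[of v] field_simps)
      moreover have "exp ((p \<bullet> p) * (- 1 / (2 * lam))) = g p" for p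
        by (simp add: g_def power2_norm_eq_inner)
      ultimately have "(g has_derivative (\<lambda>v. g p * (- (p \<bullet> v) / lam))) (at p)"
        by (simp only:)
      then have "((\<lambda>p. (u q / Z1) * (g p / Z2)) has_derivative (\<lambda>v. (u q / Z1) * (g p * (- (p \<bullet> v) / lam) / Z2))) (at p)"
        by (intro has_derivative_mult_right bounded_linear.has_derivative[OF bounded_linear_divide])
      moreover have "(\<lambda>v. (u q / Z1) * (g p * (- (p \<bullet> v) / lam) / Z2)) = (\<lambda>v. - (\<rho> (q, p) / lam) * (p \<bullet> v))"
        using Z1 Z2 lam by (auto simp: fun_eq_iff \<rho>_def field_simps)
      ultimately show ?thesis by (simp add: \<rho>_def)
    qed
    have sum_inner: "(\<Sum>i\<in>Basis. (x \<bullet> i) * (y \<bullet> i)) = x \<bullet> y" for x y :: 'a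
      by (rule euclidean_inner[symmetric])
    have trace: "(\<Sum>i\<in>Basis. (\<alpha> *\<^sub>R i + (\<beta> * (x \<bullet> i)) *\<^sub>R y) \<bullet> i) = \<alpha> * DIM('a) + \<beta> * (x \<bullet> y)"
      for \<alpha> \<beta> :: real and x y :: 'a
    proof -
      have "(\<Sum>i\<in>Basis. (\<alpha> *\<^sub>R i + (\<beta> * (x \<bullet> i)) *\<^sub>R y) \<bullet> i) = (\<Sum>i\<in>(Basis :: 'a set). \<alpha> + \<beta> * ((x \<bullet> i) * (y \<bullet> i)))"
        by (intro sum.cong) (auto simp: inner_add_left)
      also have "\<dots> = \<alpha> * DIM('a) + \<beta> * (\<Sum>i\<in>Basis. (x \<bullet> i) * (y \<bullet> i))"
        by (simp add: sum.distrib sum_distrib_left)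
      finally show ?thesis by (simp only: sum_inner)
    qed
    have "divergence (\<lambda>q. \<rho> (q, p) *\<^sub>R p) q = (\<Sum>i\<in>Basis. ((- (?r / lam) * (h \<bullet> i)) *\<^sub>R p) \<bullet> i)"
      using dq by (intro divergence_eqI has_derivative_scaleR_left)
    also have "\<dots> = - (?r / lam) * (\<Sum>i\<in>Basis. (h \<bullet> i) * (p \<bullet> i))"
      by (simp only: inner_scaleR_left sum_distrib_left mult.assoc)
    also have "\<dots> = - (?r / lam) * (h \<bullet> p)" by (simp only: sum_inner)
    finally have 1: "divergence (\<lambda>q. \<rho> (q, p) *\<^sub>R p) q = - (?r / lam) * (h \<bullet> p)" .
    have "((\<lambda>p. \<rho> (q, p) *\<^sub>R (h + p)) has_derivative
        (\<lambda>v. ?r *\<^sub>R v + (- (?r / lam) * (p \<bullet> v)) *\<^sub>R (h + p))) (at p)"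
      using has_derivative_scaleR[OF dp[of p] has_derivative_add[OF has_derivative_const[of h] has_derivative_ident]]
      by simp
    then have "divergence (\<lambda>p. \<rho> (q, p) *\<^sub>R (h + p)) p
        = (\<Sum>i\<in>Basis. (?r *\<^sub>R i + (- (?r / lam) * (p \<bullet> i)) *\<^sub>R (h + p)) \<bullet> i)"
      by (rule divergence_eqI)
    then have 2: "divergence (\<lambda>p. \<rho> (q, p) *\<^sub>R (h + p)) p = ?r * DIM('a) + - (?r / lam) * (p \<bullet> (h + p))"
      by (simp only: trace)
    have gr: "grad (\<lambda>p. \<rho> (q, p)) p = (- (\<rho> (q, p) / lam)) *\<^sub>R p" for p
      using dp[of p] by (intro grad_eqI) simp
    have "((\<lambda>p. - (\<rho> (q, p) / lam)) has_derivative (\<lambda>v. - (- (?r / lam) * (p \<bullet> v) / lam))) (at p)"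
      using dp[of p] by (intro has_derivative_minus bounded_linear.has_derivative[OF bounded_linear_divide])
    moreover have "- (- (?r / lam) * (p \<bullet> v) / lam) = (?r / lam / lam) * (p \<bullet> v)" for v by simp
    ultimately have "((\<lambda>p. - (\<rho> (q, p) / lam)) has_derivative (\<lambda>v. (?r / lam / lam) * (p \<bullet> v))) (at p)"
      by (simp only:)
    from has_derivative_scaleR[OF this has_derivative_ident]
    have "divergence (\<lambda>p. (- (\<rho> (q, p) / lam)) *\<^sub>R p) p
        = (\<Sum>i\<in>Basis. ((- (?r / lam)) *\<^sub>R i + ((?r / lam / lam) * (p \<bullet> i)) *\<^sub>R p) \<bullet> i)"
      by (rule divergence_eqI)
    also have "\<dots> = - (?r / lam) * DIM('a) + (?r / lam / lam) * (p \<bullet> p)" by (rule trace)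
    finally have 3: "laplacian (\<lambda>p. \<rho> (q, p)) p = - (?r / lam) * DIM('a) + (?r / lam / lam) * (p \<bullet> p)"
      unfolding laplacian_def gr[abs_def] .
    show ?thesis
      unfolding h_def[symmetric] 1 2 3 using lam by (simp add: field_simps inner_add_right inner_commute[of h])
  qed
  show ?thesis
    unfolding stationary_measure_def
    using prob bdd conv_psi conv_grad C2 pde by blast
qed

end

section \<open>The assumptions on the two potentials\<close>

lemma hessian_is_derivative_of_grad:
  fixes V :: "real ^ 'd \<Rightarrow> real"
  assumes "Ck 2 V"
  shows "(grad V has_derivative (\<lambda>v. hessian V x *v v)) (at x)"
    and "v \<bullet> (hessian V x *v v) = (\<Sum>i\<in>Basis. \<Sum>j\<in>Basis. (v \<bullet> i) * (v \<bullet> j) *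
        frechet_derivative (\<lambda>x. frechet_derivative V (at x) i) (at x) j)"
proof -
  define h where "h i x = frechet_derivative (\<lambda>x. frechet_derivative V (at x) i) (at x)" for i x
  have h: "((\<lambda>x. frechet_derivative V (at x) i) has_derivative h i x) (at x)" if "i \<in> Basis" for i
    unfolding h_def using assms that unfolding numeral_2_eq_2 by (intro Ck_SucD(1) Ck_SucD(2))
  have D: "(grad V has_derivative (\<lambda>v. \<Sum>i\<in>Basis. h i x v *\<^sub>R i)) (at x)"
    unfolding grad_def[abs_def] using h by (intro has_derivative_sum has_derivative_scaleR_left) auto
  have "hessian V x *v v = (\<Sum>i\<in>Basis. h i x v *\<^sub>R i)" for v
    unfolding hessian_def frechet_derivative_at[OF D, symmetric]
    by (rule matrix_works) (use D in \<open>simp add: has_derivative_linear linear_matrix_vector_mul_eq\<close>)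
  then have eq: "(\<lambda>v. hessian V x *v v) = (\<lambda>v. \<Sum>i\<in>Basis. h i x v *\<^sub>R i)" by auto
  show "(grad V has_derivative (\<lambda>v. hessian V x *v v)) (at x)" unfolding eq by (rule D)
  have "h i x v = (\<Sum>j\<in>Basis. (v \<bullet> j) * h i x j)" if "i \<in> Basis" for i
  proof -
    have lin: "linear (h i x)" using h[OF that] by (rule has_derivative_linear)
    have "h i x v = h i x (\<Sum>j\<in>Basis. (v \<bullet> j) *\<^sub>R j)" by (simp add: euclidean_representation)
    then show ?thesis by (simp add: linear_sum[OF lin] linear_scale[OF lin])
  qed
  then show "v \<bullet> (hessian V x *v v) = (\<Sum>i\<in>Basis. \<Sum>j\<in>Basis. (v \<bullet> i) * (v \<bullet> j) *
        frechet_derivative (\<lambda>x. frechet_derivative V (at x) i) (at x) j)"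
    unfolding fun_cong[OF eq, of v] h_def[symmetric]
    by (simp add: inner_sum_right sum_distrib_left mult_ac)
qed

text \<open>Outside \<open>K\<close> the form is nonnegative, and on \<open>K\<close> the second derivatives are bounded by continuity.\<close>

lemma hessian_bounded_below:
  fixes V :: "real ^ 'd \<Rightarrow> real"
  assumes V: "Ck 2 V" and K: "compact K" "\<And>x. x \<notin> K \<Longrightarrow> pos_definite (hessian V x)"
  shows "\<exists>B\<ge>0. \<forall>x v. v \<bullet> (hessian V x *v v) \<ge> - (B * (norm v)\<^sup>2)"
proof -
  define h where "h i j x = frechet_derivative (\<lambda>x. frechet_derivative V (at x) i) (at x) j" for i j x
  define S where "S x = (\<Sum>i\<in>Basis. \<Sum>j\<in>Basis. \<bar>h i j x\<bar>)" for x
  have "continuous_on UNIV (h i j)" if "i \<in> Basis" "j \<in> Basis" for i j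
    using V that unfolding numeral_2_eq_2 h_def[abs_def] by simp
  then have "continuous_on UNIV S" unfolding S_def by (intro continuous_on_sum continuous_on_rabs) auto
  then have "continuous_on K S" by (rule continuous_on_subset) simp
  then have "compact (S ` K)" using K(1) by (rule compact_continuous_image)
  then have "bdd_above (S ` K)" by (intro bounded_imp_bdd_above compact_imp_bounded)
  then obtain b where b: "\<And>x. x \<in> K \<Longrightarrow> S x \<le> b" unfolding bdd_above_def by blast
  have "v \<bullet> (hessian V x *v v) \<ge> - (\<bar>b\<bar> * (norm v)\<^sup>2)" for x v
  proof (cases "x \<in> K")
    case True
    have "\<bar>v \<bullet> (hessian V x *v v)\<bar> \<le> (\<Sum>i\<in>Basis. \<Sum>j\<in>Basis. \<bar>(v \<bullet> i) * (v \<bullet> j) * h i j x\<bar>)"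
      unfolding hessian_is_derivative_of_grad(2)[OF V] h_def[symmetric]
      by (intro order_trans[OF sum_abs] sum_mono sum_abs)
    also have "\<dots> \<le> (\<Sum>i\<in>Basis. \<Sum>j\<in>Basis. (norm v)\<^sup>2 * \<bar>h i j x\<bar>)"
    proof (intro sum_mono)
      fix i j :: "real ^ 'd" assume ij: "i \<in> Basis" "j \<in> Basis"
      have "\<bar>v \<bullet> i\<bar> * \<bar>v \<bullet> j\<bar> \<le> norm v * norm v"
        using ij by (intro mult_mono Basis_le_norm) auto
      then show "\<bar>(v \<bullet> i) * (v \<bullet> j) * h i j x\<bar> \<le> (norm v)\<^sup>2 * \<bar>h i j x\<bar>"
        by (simp add: abs_mult power2_eq_square mult_right_mono)
    qed
    also have "\<dots> = (norm v)\<^sup>2 * S x" by (simp add: S_def sum_distrib_left)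
    also have "\<dots> \<le> (norm v)\<^sup>2 * \<bar>b\<bar>" using b[OF True] by (intro mult_left_mono) auto
    finally show ?thesis by (simp add: mult.commute)
  next
    case False
    have "v \<bullet> (hessian V x *v v) \<ge> 0"
      using K(2)[OF False] by (cases "v = 0") (auto simp: pos_definite_def less_imp_le)
    then show ?thesis by (smt (verit) abs_ge_zero mult_nonneg_nonneg zero_le_power2)
  qed
  then show ?thesis by (intro exI[of _ "\<bar>b\<bar>"]) auto
qed

text \<open>Along the ray through \<open>x\<close> the function \<open>t \<mapsto> V(t x) + (B / 2) |x|\<^sup>2 t\<^sup>2\<close> is convex; compare its value at \<open>r\<close> with the chord
  between \<open>0\<close> and \<open>1\<close>.\<close>

lemma radial_semiconvexity:
  fixes V :: "real ^ 'd \<Rightarrow> real"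
  assumes V: "Ck 2 V" and B: "\<And>x v. v \<bullet> (hessian V x *v v) \<ge> - (B * (norm v)\<^sup>2)" "B \<ge> 0"
    and r: "0 \<le> r" "r \<le> 1"
  shows "V x - V (r *\<^sub>R x) \<ge> (1 - r) * (V x - V 0 - B / 2 * (norm x)\<^sup>2)"
proof -
  define b where "b = B * (norm x)\<^sup>2"
  have b: "b \<ge> 0" using B(2) by (simp add: b_def)
  have dV: "(V has_derivative (\<lambda>v. grad V y \<bullet> v)) (at y)" for y
    using V by (intro has_derivative_grad) (auto simp: numeral_2_eq_2 differentiable_on_def)
  have line: "((\<lambda>t. t *\<^sub>R x) has_derivative (\<lambda>s. s *\<^sub>R x)) (at t)" for t :: real
    by (auto intro!: derivative_eq_intros)
  have d1: "((\<lambda>t. V (t *\<^sub>R x)) has_real_derivative grad V (t *\<^sub>R x) \<bullet> x) (at t)" for t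
    using has_derivative_compose[OF line dV] by (simp add: has_field_derivative_def mult.commute[of "_ \<bullet> _"] mult_commute_abs)
  have d2: "((\<lambda>t. grad V (t *\<^sub>R x) \<bullet> x) has_real_derivative x \<bullet> (hessian V (t *\<^sub>R x) *v x)) (at t)" for t
    using has_derivative_inner_left[OF has_derivative_compose[OF line hessian_is_derivative_of_grad(1)[OF V]], of x t]
    by (simp add: has_field_derivative_def matrix_vector_mult_scaleR inner_commute mult_commute_abs)
  have "convex_on UNIV (\<lambda>t. V (t *\<^sub>R x) + b / 2 * t\<^sup>2)"
  proof (rule f''_ge0_imp_convex)
    show "((\<lambda>t. V (t *\<^sub>R x) + b / 2 * t\<^sup>2) has_real_derivative grad V (t *\<^sub>R x) \<bullet> x + b * t) (at t)" for t
      by (rule derivative_eq_intros d1 | simp)+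
    show "((\<lambda>t. grad V (t *\<^sub>R x) \<bullet> x + b * t) has_real_derivative x \<bullet> (hessian V (t *\<^sub>R x) *v x) + b) (at t)" for t
      by (rule derivative_eq_intros d2 | simp)+
    show "x \<bullet> (hessian V (t *\<^sub>R x) *v x) + b \<ge> 0" for t
      using B(1)[of x "t *\<^sub>R x"] by (simp add: b_def)
  qed simp
  from convex_onD[OF this r, of 0 1]
  have "V (r *\<^sub>R x) + b / 2 * r\<^sup>2 \<le> (1 - r) * V 0 + r * (V x + b / 2)" by simp
  moreover have "0 \<le> (1 - r) * (1 - r) * (b / 2)" using b r by simp
  ultimately have "V x - V (r *\<^sub>R x) \<ge> (1 - r) * (V x - V 0 - b / 2)"
    by (simp add: power2_eq_square algebra_simps diff_divide_distrib)
  then show ?thesis by (simp add: b_def)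
qed

lemma even_convex_nonneg:
  fixes f :: "real \<Rightarrow> real"
  assumes "convex_on UNIV f" "\<And>r. f (- r) = f r" "f 0 = 0"
  shows "f t \<ge> 0"
  using convex_onD[OF assms(1), of "1/2" "-t" t] assms(2,3) by simp

text \<open>On the ray through \<open>z\<close> the function \<open>\<psi>\<close> is \<open>r \<mapsto> G(r |z|)\<close>, also for negative \<open>r\<close> since \<open>G\<close> is even.  The tangent
  of \<open>G\<close> at \<open>|z|\<close> lies below \<open>G(0) = 0\<close> at the origin, so \<open>|z| G'(|z|) \<ge> G(|z|)\<close>.  Differentiability of \<open>\<psi>\<close> at
  the origin comes from its being a polynomial in the coordinates.\<close>

lemma convex_radial_derivative_ge:
  fixes G :: "real poly"
  assumes conv: "convex_on UNIV (poly G)" and even: "\<And>r. poly G (- r) = poly G r" and zero: "poly G 0 = 0"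
    and psi: "\<And>x::'a::euclidean_space. \<psi> x = poly G (norm x)"
  shows "\<exists>D. (\<psi> has_derivative D) (at z) \<and> D z \<ge> \<psi> z"
proof -
  obtain N \<phi> \<eta> where sep: "separates N \<phi> \<eta> (\<lambda>x y::'a. poly G (norm (x - y)))"
    using separable_imp_separates[OF separable_even_poly_norm_diff[OF even]] by blast
  have "poly G (norm (x - y)) = (\<Sum>i<N. \<phi> i x * \<eta> i y)" for x y
    using sep by (simp add: separates_def)
  from this[of _ 0] have "\<psi> x = (\<Sum>i<N. \<phi> i x * \<eta> i 0)" for x
    by (simp add: psi)
  then have "\<psi> = (\<lambda>x. \<Sum>i<N. \<phi> i x * \<eta> i 0)" by auto
  moreover have "real_polynomial_function (\<lambda>x. \<Sum>i<N. \<phi> i x * \<eta> i 0)"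
    using sep by (intro real_polynomial_function_sum real_polynomial_function.intros(2,4)) (auto simp: separates_def)
  ultimately have "\<psi> differentiable (at z)" by (simp add: differentiable_at_real_polynomial_function)
  then obtain D where D: "(\<psi> has_derivative D) (at z)" by (auto simp: differentiable_def)
  have lin: "linear D" using D by (rule has_derivative_linear)
  have "((\<lambda>r. \<psi> (r *\<^sub>R z)) has_derivative (\<lambda>s. D (s *\<^sub>R z))) (at 1)"
    using D by (intro has_derivative_compose[of "\<lambda>r. r *\<^sub>R z" "\<lambda>s. s *\<^sub>R z" 1 UNIV \<psi> D])
      (auto intro!: derivative_eq_intros)
  moreover have "(\<lambda>s. D (s *\<^sub>R z)) = (*) (D z)" by (auto simp: fun_eq_iff linear_scale[OF lin])
  ultimately have d1: "((\<lambda>r. \<psi> (r *\<^sub>R z)) has_real_derivative D z) (at 1)"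
    by (simp add: has_field_derivative_def)
  have "\<psi> (r *\<^sub>R z) = poly G (r * norm z)" for r
  proof -
    have "poly G (\<bar>r\<bar> * norm z) = poly G (r * norm z)"
      using even[of "r * norm z"] by (cases "r \<ge> 0") auto
    then show ?thesis by (simp add: psi)
  qed
  then have "((\<lambda>r. poly G (r * norm z)) has_real_derivative D z) (at 1)" using d1 by simp
  moreover have "((\<lambda>r. poly G (r * norm z)) has_real_derivative poly (pderiv G) (norm z) * norm z) (at 1)"
    by (auto intro!: derivative_eq_intros)
  ultimately have Dz: "D z = poly (pderiv G) (norm z) * norm z" by (rule DERIV_unique)
  have "poly G 0 - poly G (norm z) \<ge> poly (pderiv G) (norm z) * (0 - norm z)"
    by (rule convex_on_imp_above_tangent[OF conv]) (auto intro!: DERIV_subset[OF poly_DERIV])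
  then have "D z \<ge> \<psi> z" by (simp add: Dz psi zero)
  with D show ?thesis by blast
qed

text \<open>With \<open>d\<close> the degree, \<open>G(u)\<close> is at most a multiple of \<open>(1 + u)\<^sup>d\<close>.  Conversely \<open>(2 + t)\<^sup>d\<close> is at most a multiple of
  \<open>1 + G(t)\<close>: for large \<open>t\<close> because the leading coefficient is positive, and for the remaining \<open>t\<close>
  because it is bounded.\<close>

lemma nonneg_poly_shift_bound:
  fixes G :: "real poly"
  assumes nonneg: "\<And>t. poly G t \<ge> 0"
  shows "\<exists>K\<ge>0. \<forall>t u. 0 \<le> u \<longrightarrow> u \<le> t + 1 \<longrightarrow> poly G u \<le> K * (1 + poly G t)"
proof (cases "G = 0")
  case True
  then show ?thesis by (intro exI[of _ 0]) auto
next
  case False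
  let ?d = "degree G" and ?l = "lead_coeff G"
  have lim: "((\<lambda>x. poly G x / x ^ ?d) \<longlongrightarrow> ?l) at_top"
    by (rule filterlim_mono[OF poly_divide_tendsto_aux order_refl at_top_le_at_infinity])
  have "eventually (\<lambda>x. 0 \<le> poly G x / x ^ ?d) at_top"
    using eventually_ge_at_top[of 0] by eventually_elim (simp add: nonneg)
  then have "?l \<ge> 0" by (rule tendsto_lowerbound[OF lim]) simp
  then have l: "?l > 0" using False by (simp add: less_le)
  have "eventually (\<lambda>x. poly G x / x ^ ?d > ?l / 2) at_top"
    using l by (intro order_tendstoD(1)[OF lim]) auto
  then obtain T0 where T0: "\<And>x. x \<ge> T0 \<Longrightarrow> poly G x / x ^ ?d > ?l / 2"
    unfolding eventually_at_top_linorder by blast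
  define T where "T = max 1 T0"
  define A where "A = (\<Sum>i\<le>?d. \<bar>coeff G i\<bar>)"
  define k where "k = (2 + T) ^ ?d + 3 ^ ?d * (2 / ?l)"
  have T: "T \<ge> 1" by (simp add: T_def)
  have k: "k \<ge> 0" using T l by (simp add: k_def)
  have A: "A \<ge> 0" by (simp add: A_def sum_nonneg)
  have up: "poly G u \<le> A * (1 + u) ^ ?d" if "u \<ge> 0" for u
  proof -
    have "poly G u \<le> (\<Sum>i\<le>?d. \<bar>coeff G i\<bar> * u ^ i)"
      unfolding poly_altdef using that by (intro sum_mono mult_right_mono) auto
    also have "\<dots> \<le> (\<Sum>i\<le>?d. \<bar>coeff G i\<bar> * (1 + u) ^ ?d)"
    proof (intro sum_mono mult_left_mono)
      fix i assume "i \<in> {..?d}"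
      have "u ^ i \<le> (1 + u) ^ i" using that by (intro power_mono) auto
      also have "\<dots> \<le> (1 + u) ^ ?d" using that \<open>i \<in> {..?d}\<close> by (intro power_increasing) auto
      finally show "u ^ i \<le> (1 + u) ^ ?d" .
    qed auto
    finally show ?thesis by (simp add: A_def sum_distrib_right)
  qed
  have low: "(2 + t) ^ ?d \<le> k * (1 + poly G t)" if "t \<ge> -1" for t
  proof (cases "t \<le> T")
    case True
    have "(2 + t) ^ ?d \<le> (2 + T) ^ ?d" using True that by (intro power_mono) auto
    also have "\<dots> \<le> k" using l by (simp add: k_def)
    also have "\<dots> \<le> k * (1 + poly G t)" using k nonneg[of t] by (simp add: mult_le_cancel_left1)
    finally show ?thesis .
  next
    case False
    then have t: "t \<ge> 1" "t \<ge> T0" by (auto simp: T_def)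
    have "(2 + t) ^ ?d \<le> (3 * t) ^ ?d" using t by (intro power_mono) auto
    also have "\<dots> = 3 ^ ?d * t ^ ?d" by (rule power_mult_distrib)
    also have "t ^ ?d \<le> 2 / ?l * poly G t"
      using T0[OF t(2)] l t(1) by (simp add: field_simps)
    also have "3 ^ ?d * (2 / ?l * poly G t) \<le> k * (1 + poly G t)"
    proof -
      have "3 ^ ?d * (2 / ?l) \<le> k" using T by (simp add: k_def)
      then have "3 ^ ?d * (2 / ?l) * poly G t \<le> k * poly G t" using nonneg by (intro mult_right_mono)
      then show ?thesis using k by (simp add: distrib_left)
    qed
    finally show ?thesis by simp
  qed
  have "poly G u \<le> (A * k) * (1 + poly G t)" if "0 \<le> u" "u \<le> t + 1" for t u
  proof -
    have "poly G u \<le> A * (1 + u) ^ ?d" using that(1) by (rule up)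
    also have "\<dots> \<le> A * (2 + t) ^ ?d" using that A by (intro mult_left_mono power_mono) auto
    also have "\<dots> \<le> A * (k * (1 + poly G t))" using that A by (intro mult_left_mono low) auto
    finally show ?thesis by (simp add: mult.assoc)
  qed
  then show ?thesis using A k by (intro exI[of _ "A * k"]) auto
qed

section \<open>Existence of a stationary measure\<close>

theorem proposition2:
  fixes V \<psi> :: "real ^ 'd \<Rightarrow> real" and G :: "real poly" and lam :: real
  assumes V1: "smooth V"
      "\<exists>m::nat. \<exists>C>0. m \<ge> 1 \<and> ((\<lambda>x. V x / norm x ^ (2 * m)) \<longlongrightarrow> C) at_infinity"
    and V2: "finite {x. grad V x = 0}"
    and V3: "\<exists>C2>0. \<exists>C4>0. \<forall>x. V x \<ge> C4 * norm x ^ 4 - C2 * norm x ^ 2"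
    and V4: "filterlim (\<lambda>x. min_eigenvalue (hessian V x)) at_top at_infinity"
      "\<exists>K. compact K \<and> {x. grad V x = 0} \<subseteq> K \<and> (\<forall>x. x \<notin> K \<longrightarrow> pos_definite (hessian V x))"
    and psi1: "\<And>x. \<psi> x = poly G (norm x)" "\<And>r. poly G (- r) = poly G r"
      "\<exists>n::nat. degree G = 2 * n \<and> 2 * n \<ge> 2"
    and psi2: "convex_on UNIV (poly G)" "convex_on UNIV (poly (pderiv (pderiv G)))"
    and psi3: "poly G 0 = 0"
    and lam: "lam > 0"
  shows "\<exists>\<rho>. stationary_measure V \<psi> lam \<rho>"
proof -
  have V: "Ck 2 V" using V1(1) by (simp add: smooth_def)
  obtain K where "compact K" "\<And>x. x \<notin> K \<Longrightarrow> pos_definite (hessian V x)"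
    using V4(2) by blast
  then obtain B where B: "B \<ge> 0" "\<And>x v. v \<bullet> (hessian V x *v v) \<ge> - (B * (norm v)\<^sup>2)"
    using hessian_bounded_below[OF V] by blast
  obtain C2 C4 where C4: "C4 > 0" "\<And>x. V x \<ge> C4 * norm x ^ 4 - C2 * norm x ^ 2"
    using V3 by blast
  have nonneg: "poly G t \<ge> 0" for t
    using psi2(1) psi1(2) psi3 by (rule even_convex_nonneg)
  obtain L where L: "L \<ge> 0" "\<forall>t u. 0 \<le> u \<longrightarrow> u \<le> t + 1 \<longrightarrow> poly G u \<le> L * (1 + poly G t)"
    using nonneg_poly_shift_bound[of G] nonneg by blast
  obtain N \<phi> \<eta> where sep: "separates N \<phi> \<eta> (\<lambda>x y::real ^ 'd. poly G (norm (x - y)))"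
    using separable_imp_separates[OF separable_even_poly_norm_diff[OF psi1(2)]] by blast
  interpret mean_field V \<psi> lam C2 C4 "B / 2" L N \<phi> \<eta>
  proof
    show "lam > 0" by (rule lam)
    show "continuous_on UNIV V"
      using V by (auto simp: numeral_2_eq_2 intro: differentiable_imp_continuous_on)
    show "C4 > 0" "\<And>x. V x \<ge> C4 * norm x ^ 4 - C2 * norm x ^ 2" by (fact C4)+
    show "V x - V (r *\<^sub>R x) \<ge> (1 - r) * (V x - V 0 - B / 2 * (norm x)\<^sup>2)" if "0 \<le> r" "r \<le> 1" for x r
      using that by (intro radial_semiconvexity[OF V B(2,1)])
    show "\<psi> z \<ge> 0" for z by (simp add: psi1(1) nonneg)
    show "\<psi> (- z) = \<psi> z" for z by (simp add: psi1(1))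
    show "\<exists>D. (\<psi> has_derivative D) (at z) \<and> D z \<ge> \<psi> z" for z
      using psi2(1) psi1(2) psi3 psi1(1) by (rule convex_radial_derivative_ge)
    show "\<psi> (z + h) \<le> L * (1 + \<psi> z)" if "norm h \<le> 1" for z h
      unfolding psi1(1) using norm_triangle_ineq[of z h] that by (intro L(2)[rule_format]) auto
    show "L \<ge> 0" by (rule L(1))
    show "separates N \<phi> \<eta> (\<lambda>x y. \<psi> (x - y))" using sep by (simp add: psi1(1))
  qed
  show ?thesis by (rule stationary_measure_exists[OF V])
qed

end
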